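(* There exist constants $\gamma_1>0$ and $\mu>0$ such that for any $\lambda,\lambda'\in\Omega$ with $\|\lambda'-\lambda\|\le\gamma_1$, it holds that $$\|\nabla D(\lambda')-\nabla D(\lambda)\|\le\mu\|\lambda'-\lambda\|.$$
   Context: Consider the discrete-time linear system $x_{t+1}=Ax_t+Bu_t$, with state $x_t\in\mathbb R^n$, input $u_t\in\mathbb R^m$, $(A,B)$ controllable, and random initial state $x_0$ with zero mean and $\mathbb E[x_0x_0^\top]=I_n$. Let $Q_0,R_0>0$ (symmetric positive definite) and $Q_i,R_i\ge 0$ (symmetric positive semidefinite) for $i\in\{1,\dots,N\}$, where $Q_i\in\mathbb R^{n\times n}$, $R_i\in\mathbb R^{m\times m}$, and let $c_1,\dots,c_N$ be real constants. For $K\in\mathbb R^{m\times n}$ and $i\in\{0,\dots,N\}$ let $J_i(K)=\mathbb E_{x_0}\big[\sum_{t=0}^\infty (x_t^\top Q_ix_t+u_t^\top R_iu_t)\big]$ under the state feedback $u_t=-Kx_t$. Let $\rho(\cdot)$ be the spectral radius, $\mathcal S=\{K\in\mathbb R^{m\times n}:\rho(A-BK)<1\}$, and $\|\cdot\|$ the 2-norm. For $\lambda\in\mathbb R^N_+$ (entrywise nonnegative vectors), define $\mathcal L(K,\lambda)=J_0(K)+\sum_{i=1}^N\lambda_i(J_i(K)-c_i)$ and $D(\lambda)=\min_{K\in\mathcal S}\mathcal L(K,\lambda)$; $K^*_\lambda$ denotes the unique minimizer of $\mathcal L(\cdot,\lambda)$ over $\mathcal S$. The dual function $D$ is differentiable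 on $\mathbb R^N_+$ with $\nabla D(\lambda)=[J_1(K^*_\lambda)-c_1,\dots,J_N(K^*_\lambda)-c_N]^\top$. Slater's condition is assumed: there is $\widetilde K\in\mathcal S$ with $J_i(\widetilde K)<c_i$ for all $i\in\{1,\dots,N\}$; then an optimal multiplier $\lambda^*\in\arg\max_{\lambda\ge0}D(\lambda)$ exists. $\Omega\subset\mathbb R^N_+$ is a compact set with $\lambda^*\in\Omega$. *)

theory Defs
  imports "HOL-Probability.Probability"
begin

definition pos_def :: "real ^ 'n ^ 'n \<Rightarrow> bool" where
  "pos_def P \<longleftrightarrow> transpose P = P \<and> (\<forall>x. x \<noteq> 0 \<longrightarrow> x \<bullet> (P *v x) > 0)"

definition pos_semidef :: "real ^ 'n ^ 'n \<Rightarrow> bool" where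
  "pos_semidef P \<longleftrightarrow> transpose P = P \<and> (\<forall>x. x \<bullet> (P *v x) \<ge> 0)"

definition eigenvalues :: "real ^ 'n ^ 'n \<Rightarrow> complex set" where
  "eigenvalues P =
     {z. \<exists>v :: complex ^ 'n. v \<noteq> 0 \<and> (\<chi> i j. complex_of_real (P $ i $ j)) *v v = z *s v}"

definition spec_radius :: "real ^ 'n ^ 'n \<Rightarrow> real" where
  "spec_radius P = (SUP z\<in>eigenvalues P. cmod z)"

primrec trajectory ::
  "real ^ 'n ^ 'n \<Rightarrow> real ^ 'm ^ 'n \<Rightarrow> (nat \<Rightarrow> real ^ 'm) \<Rightarrow> real ^ 'n \<Rightarrow> nat \<Rightarrow> real ^ 'n" where
  "trajectory A B u x 0 = x"
| "trajectory A B u x (Suc t) = A *v trajectory A B u x t + B *v u t"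

text \<open>Every state can be steered to every other state in finitely many steps. As the target is
  arbitrary, this is what is called reachability in texts that reserve controllability for steering
  to the origin, and it amounts to the Kalman rank condition also for singular \<open>A\<close>.\<close>
definition controllable :: "real ^ 'n ^ 'n \<Rightarrow> real ^ 'm ^ 'n \<Rightarrow> bool" where
  "controllable A B \<longleftrightarrow> (\<forall>x y. \<exists>u T. trajectory A B u x T = y)"

primrec closed_loop ::
  "real ^ 'n ^ 'n \<Rightarrow> real ^ 'm ^ 'n \<Rightarrow> real ^ 'n ^ 'm \<Rightarrow> real ^ 'n \<Rightarrow> nat \<Rightarrow> real ^ 'n" where
  "closed_loop A B K x 0 = x"
| "closed_loop A B K x (Suc t) =
     A *v closed_loop A B K x t + B *v (- (K *v closed_loop A B K x t))"

definition stabilizing :: "real ^ 'n ^ 'n \<Rightarrow> real ^ 'm ^ 'n \<Rightarrow> (real ^ 'n ^ 'm) set" where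
  "stabilizing A B = {K. spec_radius (A - B ** K) < 1}"

text \<open>The series and the expectation are real-valued, so the value is only meaningful where both
  converge; this is the case for every stabilizing gain when the initial state has finite second
  moments.\<close>
definition lq_cost ::
  "'a measure \<Rightarrow> ('a \<Rightarrow> real ^ 'n) \<Rightarrow> real ^ 'n ^ 'n \<Rightarrow> real ^ 'm ^ 'n \<Rightarrow>
   real ^ 'n ^ 'n \<Rightarrow> real ^ 'm ^ 'm \<Rightarrow> real ^ 'n ^ 'm \<Rightarrow> real" where
  "lq_cost M x0 A B Q R K =
     (\<integral>\<omega>. (\<Sum>t. let x = closed_loop A B K (x0 \<omega>) t; u = - (K *v x)
                 in x \<bullet> (Q *v x) + u \<bullet> (R *v u)) \<partial>M)"

definition lagrangian ::
  "'a measure \<Rightarrow> ('a \<Rightarrow> real ^ 'n) \<Rightarrow> real ^ 'n ^ 'n \<Rightarrow> real ^ 'm ^ 'n \<Rightarrow>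
   real ^ 'n ^ 'n \<Rightarrow> real ^ 'm ^ 'm \<Rightarrow> ('k::finite \<Rightarrow> real ^ 'n ^ 'n) \<Rightarrow> ('k \<Rightarrow> real ^ 'm ^ 'm) \<Rightarrow>
   ('k \<Rightarrow> real) \<Rightarrow> real ^ 'n ^ 'm \<Rightarrow> real ^ 'k \<Rightarrow> real" where
  "lagrangian M x0 A B Q0 R0 Q R c K l =
     lq_cost M x0 A B Q0 R0 K + (\<Sum>i\<in>UNIV. l $ i * (lq_cost M x0 A B (Q i) (R i) K - c i))"

text \<open>\<open>LEAST\<close> rather than \<open>INF\<close>: the dual function is the attained minimum.\<close>
definition dual_fun ::
  "'a measure \<Rightarrow> ('a \<Rightarrow> real ^ 'n) \<Rightarrow> real ^ 'n ^ 'n \<Rightarrow> real ^ 'm ^ 'n \<Rightarrow>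
   real ^ 'n ^ 'n \<Rightarrow> real ^ 'm ^ 'm \<Rightarrow> ('k::finite \<Rightarrow> real ^ 'n ^ 'n) \<Rightarrow> ('k \<Rightarrow> real ^ 'm ^ 'm) \<Rightarrow>
   ('k \<Rightarrow> real) \<Rightarrow> real ^ 'k \<Rightarrow> real" where
  "dual_fun M x0 A B Q0 R0 Q R c l =
     (LEAST v. \<exists>K\<in>stabilizing A B. v = lagrangian M x0 A B Q0 R0 Q R c K l)"

definition nonneg_orthant :: "(real ^ 'k) set" where
  "nonneg_orthant = {l. \<forall>i. l $ i \<ge> 0}"

text \<open>The domain of the dual function is the closed orthant, so at its boundary points the gradient
  is the one relative to the orthant; at interior points it is the ordinary gradient.\<close>
definition orthant_gradient :: "(real ^ 'k \<Rightarrow> real) \<Rightarrow> real ^ 'k \<Rightarrow> real ^ 'k" where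
  "orthant_gradient f l = (THE g. (f has_derivative (\<lambda>h. g \<bullet> h)) (at l within nonneg_orthant))"

lemma orthant_gradient_eqI:
  fixes f :: "real ^ 'k \<Rightarrow> real"
  assumes l: "l \<in> nonneg_orthant"
    and g: "(f has_derivative (\<lambda>h. g \<bullet> h)) (at l within nonneg_orthant)"
  shows "orthant_gradient f l = g"
  unfolding orthant_gradient_def
proof (rule the_equality)
  show "(f has_derivative (\<lambda>h. g \<bullet> h)) (at l within nonneg_orthant)" by fact
next
  fix g' assume g': "(f has_derivative (\<lambda>h. g' \<bullet> h)) (at l within nonneg_orthant)"
  have "(\<lambda>h. g' \<bullet> h) = (\<lambda>h. g \<bullet> h)"
  proof (rule frechet_derivative_unique_within[OF g' g])
    fix b :: "real ^ 'k" and e :: real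
    assume b: "b \<in> Basis" and e: "e > 0"
    have "\<And>i. b $ i \<ge> 0"
      using b by (auto simp: Basis_vec_def axis_def)
    then have "l + (e / 2) *\<^sub>R b \<in> nonneg_orthant"
      using l e by (auto simp: nonneg_orthant_def)
    then show "\<exists>d. 0 < \<bar>d\<bar> \<and> \<bar>d\<bar> < e \<and> l + d *\<^sub>R b \<in> nonneg_orthant"
      using e by (intro exI[of _ "e / 2"]) auto
  qed
  then show "g' = g"
    by (metis inner_commute vector_eq_rdot)
qed

end

theory Submission
  imports Defs "HOL-Computational_Algebra.Fundamental_Theorem_Algebra"
begin

text \<open>For stabilizing \<open>K\<close> the cost is the Frobenius inner product of \<open>Q + K\<^sup>T R K\<close> with the Gramian
  \<open>\<Sum>\<^sub>t F\<^sup>t (F\<^sup>t)\<^sup>T\<close> of \<open>F = A - B K\<close>. At a minimizer the gain residual vanishes, since otherwise a short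
  step against it stays stabilizing and lowers the cost; completing the square then gives the
  growth \<open>L(K, \<lambda>) \<ge> D(\<lambda>) + r \<parallel>K - K\<^sub>\<lambda>\<parallel>\<^sup>2\<close>, where \<open>r\<close> depends on \<open>R\<^sub>0\<close> only because the Gramian dominates
  the identity. Adding this inequality for two multipliers bounds
  \<open>2 r \<parallel>K\<^sub>\<lambda> - K\<^sub>\<lambda>\<^sub>'\<parallel>\<^sup>2\<close> by \<open>\<parallel>\<lambda> - \<lambda>'\<parallel>\<close> times the change of the constraint costs, which are Lipschitz on
  sublevel sets of \<open>J\<^sub>0\<close>. Hence \<open>K\<^sub>\<lambda>\<close> and the constraint costs at \<open>K\<^sub>\<lambda>\<close> are Lipschitz in \<open>\<lambda>\<close> on bounded
  sets, and since they are supergradients of \<open>D\<close>, they form its gradient.\<close>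

section \<open>Frobenius norm and inner product of matrices\<close>

lemma matrix_norm_power2:
  fixes M :: "real ^ 'n ^ 'm"
  shows "(norm M)\<^sup>2 = (\<Sum>i\<in>UNIV. (norm (row i M))\<^sup>2)"
    and "(norm M)\<^sup>2 = (\<Sum>j\<in>UNIV. (norm (column j M))\<^sup>2)"
proof -
  show "(norm M)\<^sup>2 = (\<Sum>i\<in>UNIV. (norm (row i M))\<^sup>2)"
    by (simp add: power2_norm_eq_inner inner_vec_def row_def)
  have "(norm M)\<^sup>2 = (\<Sum>i\<in>UNIV. \<Sum>j\<in>UNIV. M $ i $ j * M $ i $ j)"
    by (simp add: power2_norm_eq_inner inner_vec_def)
  also have "\<dots> = (\<Sum>j\<in>UNIV. \<Sum>i\<in>UNIV. M $ i $ j * M $ i $ j)"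
    by (rule sum.swap)
  finally show "(norm M)\<^sup>2 = (\<Sum>j\<in>UNIV. (norm (column j M))\<^sup>2)"
    by (simp add: power2_norm_eq_inner inner_vec_def column_def)
qed

lemma norm_matrix_vector_mult_le:
  fixes M :: "real ^ 'n ^ 'm"
  shows "norm (M *v x) \<le> norm M * norm x"
proof (rule power2_le_imp_le)
  have "(norm (M *v x))\<^sup>2 = (\<Sum>i\<in>UNIV. (row i M \<bullet> x)\<^sup>2)"
    unfolding power2_norm_eq_inner inner_vec_def[of "M *v x"]
    by (simp add: matrix_vector_mul_component row_def power2_eq_square)
  also have "\<dots> \<le> (\<Sum>i\<in>UNIV. (norm (row i M))\<^sup>2 * (norm x)\<^sup>2)"
    by (intro sum_mono) (metis Cauchy_Schwarz_ineq power2_norm_eq_inner)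
  finally show "(norm (M *v x))\<^sup>2 \<le> (norm M * norm x)\<^sup>2"
    by (simp add: matrix_norm_power2(1) power_mult_distrib sum_distrib_right)
qed simp

lemma column_matrix_mult: "column j (M ** N) = M *v column j N"
  by (simp add: vec_eq_iff column_def matrix_matrix_mult_def matrix_vector_mult_def)

lemma norm_matrix_mult_le:
  fixes M :: "real ^ 'n ^ 'm" and N :: "real ^ 'p ^ 'n"
  shows "norm (M ** N) \<le> norm M * norm N"
proof (rule power2_le_imp_le)
  have "(norm (M ** N))\<^sup>2 = (\<Sum>j\<in>UNIV. (norm (M *v column j N))\<^sup>2)"
    by (simp add: matrix_norm_power2(2) column_matrix_mult)
  also have "\<dots> \<le> (\<Sum>j\<in>UNIV. (norm M * norm (column j N))\<^sup>2)"
    by (intro sum_mono power_mono norm_matrix_vector_mult_le) simp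
  also have "\<dots> = (norm M * norm N)\<^sup>2"
    by (simp add: matrix_norm_power2(2)[of N] power_mult_distrib sum_distrib_left)
  finally show "(norm (M ** N))\<^sup>2 \<le> (norm M * norm N)\<^sup>2" .
qed simp

lemma bounded_bilinear_matrix_mult:
  "bounded_bilinear ((**) :: real ^ 'n ^ 'm \<Rightarrow> real ^ 'p ^ 'n \<Rightarrow> real ^ 'p ^ 'm)"
proof
  show "\<exists>K. \<forall>M N. norm (M ** N :: real ^ 'p ^ 'm) \<le> norm (M :: real ^ 'n ^ 'm) * norm N * K"
    using norm_matrix_mult_le by (intro exI[of _ 1]) auto
qed (simp_all add: vec_eq_iff matrix_matrix_mult_def sum.distrib algebra_simps sum_distrib_left)

lemma norm_transpose: "norm (transpose M) = norm (M :: real ^ 'n ^ 'm)"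
proof -
  have "(norm (transpose M))\<^sup>2 = (norm M)\<^sup>2"
    using matrix_norm_power2(1)[of "transpose M"] matrix_norm_power2(2)[of M] by simp
  then show ?thesis by simp
qed

lemma bounded_linear_transpose: "bounded_linear (transpose :: real ^ 'n ^ 'm \<Rightarrow> real ^ 'm ^ 'n)"
  by standard (auto simp: transpose_def vec_eq_iff norm_transpose[unfolded transpose_def]
      intro!: exI[of _ 1])

text \<open>Expands products and transposes into sums of left-associated monomials, in which the
  quadratic identities for the cost become equalities of terms.\<close>

lemmas matrix_mult_simps =
  bounded_bilinear.add_left[OF bounded_bilinear_matrix_mult]
  bounded_bilinear.add_right[OF bounded_bilinear_matrix_mult]
  bounded_bilinear.diff_left[OF bounded_bilinear_matrix_mult]
  bounded_bilinear.diff_right[OF bounded_bilinear_matrix_mult]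
  bounded_bilinear.scaleR_left[OF bounded_bilinear_matrix_mult]
  bounded_bilinear.scaleR_right[OF bounded_bilinear_matrix_mult]
  bounded_bilinear.minus_left[OF bounded_bilinear_matrix_mult]
  bounded_bilinear.minus_right[OF bounded_bilinear_matrix_mult]
  linear_add[OF bounded_linear.linear[OF bounded_linear_transpose]]
  linear_diff[OF bounded_linear.linear[OF bounded_linear_transpose]]
  linear_scale[OF bounded_linear.linear[OF bounded_linear_transpose]]
  linear_neg[OF bounded_linear.linear[OF bounded_linear_transpose]]
  linear_0[OF bounded_linear.linear[OF bounded_linear_transpose]]
  bounded_bilinear.zero_left[OF bounded_bilinear_matrix_mult]
  bounded_bilinear.zero_right[OF bounded_bilinear_matrix_mult]
  matrix_transpose_mul matrix_mul_assoc transpose_transpose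

lemma matrix_inner_eq_sum: "M \<bullet> N = (\<Sum>j\<in>UNIV. column j M \<bullet> column j (N :: real ^ 'n ^ 'm))"
  unfolding inner_vec_def by (subst sum.swap) (simp add: column_def)

lemma matrix_inner_mult_left:
  fixes M :: "real ^ 'n ^ 'm" and N :: "real ^ 'p ^ 'n"
  shows "(M ** N) \<bullet> X = N \<bullet> (transpose M ** X)"
  unfolding matrix_inner_eq_sum column_matrix_mult
  by (intro sum.cong refl) (metis dot_lmul_matrix inner_commute transpose_matrix_vector)

lemma inner_transpose: "transpose M \<bullet> transpose N = M \<bullet> (N :: real ^ 'n ^ 'm)"
  unfolding inner_vec_def by (subst sum.swap) (simp add: transpose_def)

lemma matrix_inner_mult_right:
  fixes M :: "real ^ 'n ^ 'm" and N :: "real ^ 'p ^ 'n"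
  shows "(M ** N) \<bullet> X = M \<bullet> (X ** transpose N)"
proof -
  have "(M ** N) \<bullet> X = (transpose N ** transpose M) \<bullet> transpose X"
    by (metis inner_transpose matrix_transpose_mul)
  also have "\<dots> = transpose M \<bullet> (N ** transpose X)"
    by (simp add: matrix_inner_mult_left)
  also have "\<dots> = M \<bullet> (X ** transpose N)"
    by (metis inner_transpose matrix_transpose_mul transpose_transpose)
  finally show ?thesis .
qed

text \<open>Pairing with \<open>N ** transpose N\<close> adds up the quadratic form over the columns
  of \<open>N\<close>, so pointwise inequalities between quadratic forms pass to Frobenius inner
  products with such matrices, in particular with the terms of the Gramian.\<close>

lemma quadratic_form_inner:
  fixes W :: "real ^ 'n ^ 'n" and N :: "real ^ 'p ^ 'n"
  shows "W \<bullet> (N ** transpose N) = (\<Sum>j\<in>UNIV. column j N \<bullet> (W *v column j N))"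
proof -
  have "W \<bullet> (N ** transpose N) = (W ** N) \<bullet> N"
    by (simp add: matrix_inner_mult_right)
  then show ?thesis
    by (simp add: matrix_inner_eq_sum column_matrix_mult inner_commute)
qed

section \<open>Spectral radius and decay of powers\<close>

primrec mpow :: "real ^ 'n ^ 'n \<Rightarrow> nat \<Rightarrow> real ^ 'n ^ 'n" where
  "mpow F 0 = mat 1"
| "mpow F (Suc t) = F ** mpow F t"

text \<open>The working form of stability: the Lyapunov series needs it, and a finite bound on the
  cost delivers it when \<open>Q\<close> is positive definite. It is equivalent to spectral radius
  below one.\<close>

definition square_summable_powers :: "real ^ 'n ^ 'n \<Rightarrow> bool" where
  "square_summable_powers F \<longleftrightarrow> summable (\<lambda>t. (norm (mpow F t))\<^sup>2)"

text \<open>An indexed family is used instead of a set, since the iterates of a matrix on a vector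
  may repeat; a repetition is then itself a dependence, with coefficients 1 and -1.\<close>

lemma dependent_sequence:
  fixes f :: "nat \<Rightarrow> 'a :: euclidean_space"
  obtains u where "(\<Sum>i\<le>DIM('a). u i *\<^sub>R f i) = 0" "\<exists>i\<le>DIM('a). u i \<noteq> 0"
proof (cases "inj_on f {..DIM('a)}")
  case True
  then have "card (f ` {..DIM('a)}) = Suc DIM('a)"
    by (simp add: card_image)
  then have "dependent (f ` {..DIM('a)})"
    by (intro dependent_biggerset) auto
  then obtain w where w: "\<exists>x\<in>f ` {..DIM('a)}. w x \<noteq> 0" "(\<Sum>x\<in>f ` {..DIM('a)}. w x *\<^sub>R x) = 0"
    by (auto simp: dependent_finite)
  show ?thesis
    by (rule that[of "w \<circ> f"]) (use w True in \<open>auto simp: sum.reindex\<close>)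
next
  case False
  then obtain i j where ij: "i \<le> DIM('a)" "j \<le> DIM('a)" "i \<noteq> j" "f i = f j"
    by (auto simp: inj_on_def)
  define u :: "nat \<Rightarrow> real" where "u k = (if k = i then 1 else 0) - (if k = j then 1 else 0)" for k
  have "(\<Sum>k\<le>DIM('a). u k *\<^sub>R f k) =
      (\<Sum>k\<le>DIM('a). if k = i then f k else 0) - (\<Sum>k\<le>DIM('a). if k = j then f k else 0)"
    unfolding sum_subtractf[symmetric] by (intro sum.cong refl) (simp add: u_def)
  with ij show ?thesis
    by (intro that[of u]) (auto simp: u_def)
qed

text \<open>Every vector is annihilated by a nonzero complex polynomial in \<open>C\<close>, which splits into linear
  factors; a property therefore holds of all vectors if it can be pulled back along each
  \<open>C - a\<close>.\<close>
lemma vector_linear_factor_induct: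
  fixes C :: "complex ^ 'n ^ 'n"
  assumes zero: "X 0" and step: "\<And>a v. X (C *v v - a *s v) \<Longrightarrow> X v"
  shows "X v"
proof -
  let ?f = "\<lambda>i. ((*v) C ^^ i)"
  have lin: "?f i (x - a *s y) = ?f i x - a *s ?f i y" for i x y a
    by (induction i) (simp_all add: matrix_vector_mult_diff_distrib vector_scalar_commute)
  have *: "X v" if "p \<noteq> 0" "(\<Sum>i\<le>degree p. coeff p i *s ?f i v) = 0" for p v
    using that
  proof (induction "degree p" arbitrary: p v)
    case 0
    then have "coeff p 0 \<noteq> 0"
      by (metis leading_coeff_0_iff)
    with 0 have "v = 0"
      by auto
    then show ?case using zero by simp
  next
    case (Suc d)
    \<comment> \<open>Split off a root \<open>a\<close> of \<open>p\<close>. The cofactor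
      \<open>q\<close> has smaller degree and annihilates \<open>C *v v - a *s v\<close>, so the
      induction hypothesis applies to that vector.\<close>
    then have "\<not> constant (poly p)"
      by (simp add: constant_degree)
    then obtain a where "poly p a = 0"
      using fundamental_theorem_of_algebra by blast
    then obtain q where q: "p = [:-a, 1:] * q"
      by (auto simp: poly_eq_0_iff_dvd dvd_def)
    with Suc.prems have "q \<noteq> 0" by auto
    then have deg: "degree p = Suc (degree q)"
      unfolding q by (subst degree_mult_eq) auto
    have p: "coeff p i = coeff (pCons 0 q) i - a * coeff q i" for i
      by (simp add: q mult_pCons_left)
    have "0 = (\<Sum>i\<le>Suc (degree q). coeff p i *s ?f i v)"
      using Suc.prems deg by simp
    also have "\<dots> = (\<Sum>i\<le>Suc (degree q). coeff (pCons 0 q) i *s ?f i v)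
        - (\<Sum>i\<le>Suc (degree q). (a * coeff q i) *s ?f i v)"
      by (simp only: p sum_subtractf[symmetric] vector_sub_rdistrib)
    also have "(\<Sum>i\<le>Suc (degree q). coeff (pCons 0 q) i *s ?f i v)
        = (\<Sum>i\<le>degree q. coeff q i *s ?f i (C *v v))"
      by (subst sum.atMost_Suc_shift) (simp add: funpow_swap1)
    also have "(\<Sum>i\<le>Suc (degree q). (a * coeff q i) *s ?f i v)
        = (\<Sum>i\<le>degree q. (a * coeff q i) *s ?f i v)"
      by (simp add: coeff_eq_0)
    also have "(\<Sum>i\<le>degree q. coeff q i *s ?f i (C *v v)) - \<dots>
        = (\<Sum>i\<le>degree q. coeff q i *s ?f i (C *v v - a *s v))"
      by (simp add: lin sum_subtractf[symmetric] vector_ssub_ldistrib vector_smult_assoc mult.commute)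
    finally have "X (C *v v - a *s v)"
      using \<open>q \<noteq> 0\<close> deg Suc.hyps by (intro Suc.hyps(1)[of q]) auto
    then show ?case by (rule step)
  qed
  \<comment> \<open>One more iterate than the dimension forces a dependence. \<open>DIM\<close>
    counts real dimensions, so the coefficients of the polynomial come out real.\<close>
  obtain u where u: "(\<Sum>i\<le>DIM(complex ^ 'n). u i *\<^sub>R ?f i v) = 0" "\<exists>i\<le>DIM(complex ^ 'n). u i \<noteq> 0"
    by (rule dependent_sequence)
  define p where "p = (\<Sum>i\<le>DIM(complex ^ 'n). monom (complex_of_real (u i)) i)"
  have cp: "coeff p i = (if i \<le> DIM(complex ^ 'n) then of_real (u i) else 0)" for i
    by (auto simp: p_def coeff_sum)
  have dp: "degree p \<le> DIM(complex ^ 'n)"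
    using cp by (intro degree_le) auto
  have "(\<Sum>i\<le>degree p. coeff p i *s ?f i v) = (\<Sum>i\<le>DIM(complex ^ 'n). coeff p i *s ?f i v)"
    using dp by (intro sum.mono_neutral_left) (auto simp: coeff_eq_0)
  also have "\<dots> = (\<Sum>i\<le>DIM(complex ^ 'n). u i *\<^sub>R ?f i v)"
    by (intro sum.cong refl) (simp add: cp vec_eq_iff scaleR_conv_of_real[where 'a = complex] del: DIM_cart)
  finally have "(\<Sum>i\<le>degree p. coeff p i *s ?f i v) = 0"
    using u by simp
  moreover have "p \<noteq> 0"
    using u(2) cp by (metis coeff_0 of_real_eq_0_iff)
  ultimately show ?thesis by (intro *[of p])
qed


section \<open>Complexified matrices and their eigenvalues\<close>

abbreviation complex_matrix :: "real ^ 'n ^ 'm \<Rightarrow> complex ^ 'n ^ 'm" where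
  "complex_matrix M \<equiv> (\<chi> i j. complex_of_real (M $ i $ j))"

lemma complex_matrix_mult: "complex_matrix (M ** N) = complex_matrix M ** complex_matrix N"
  by (simp add: vec_eq_iff matrix_matrix_mult_def)

lemma complex_matrix_mpow: "complex_matrix (mpow F t) *v v = ((*v) (complex_matrix F) ^^ t) v"
proof (induction t)
  case 0
  have "complex_matrix (mat 1) = (mat 1 :: complex ^ 'a ^ 'a)"
    by (simp add: vec_eq_iff mat_def)
  then show ?case by simp
next
  case (Suc t)
  then show ?case
    by (simp add: complex_matrix_mult matrix_vector_mul_assoc[symmetric])
qed

lemma norm_complex_matrix_vector_mult_le:
  fixes M :: "real ^ 'n ^ 'm"
  shows "norm (complex_matrix M *v v) \<le> norm M * norm v"
proof -
  have "norm ((complex_matrix M *v v) $ i) \<le> norm (M $ i) * norm v" for i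
  proof -
    have "norm ((complex_matrix M *v v) $ i) \<le> (\<Sum>j\<in>UNIV. \<bar>M $ i $ j\<bar> * \<bar>norm (v $ j)\<bar>)"
      by (auto simp: matrix_vector_mult_def norm_mult intro!: order_trans[OF norm_sum])
    also have "\<dots> \<le> L2_set (\<lambda>j. M $ i $ j) UNIV * L2_set (\<lambda>j. norm (v $ j)) UNIV"
      by (rule L2_set_mult_ineq)
    finally show ?thesis
      by (simp add: norm_vec_def L2_set_def)
  qed
  then have "norm (complex_matrix M *v v) \<le> L2_set (\<lambda>i. norm (M $ i) * norm v) UNIV"
    unfolding norm_vec_def[of "complex_matrix M *v v"] by (intro L2_set_mono) auto
  also have "\<dots> = norm M * norm v"
    by (simp add: L2_set_left_distrib[symmetric] norm_vec_def)
  finally show ?thesis .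
qed

lemma mpow_eigenvector:
  assumes "complex_matrix F *v v = z *s v"
  shows "complex_matrix (mpow F t) *v v = z ^ t *s v"
  unfolding complex_matrix_mpow
  by (induction t) (simp_all add: vector_scalar_commute assms vector_smult_assoc mult.commute)

text \<open>A power of \<open>F\<close> stretches an eigenvector by the power of its eigenvalue.
  Exponent 1 makes the set of moduli bounded; a large exponent bounds the spectral radius of a
  matrix with decaying powers.\<close>

lemma eigenvalue_norm_power_le:
  assumes "z \<in> eigenvalues F"
  shows "cmod z ^ t \<le> norm (mpow F t)"
proof -
  obtain v where v: "v \<noteq> 0" "complex_matrix F *v v = z *s v"
    using assms by (auto simp: eigenvalues_def)
  have "norm (z ^ t *s v) = cmod z ^ t * norm v"
    by (simp add: norm_vec_def norm_mult L2_set_right_distrib norm_power)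
  moreover have "norm (z ^ t *s v) \<le> norm (mpow F t) * norm v"
    using norm_complex_matrix_vector_mult_le[of "mpow F t" v] mpow_eigenvector[OF v(2)] by simp
  ultimately show ?thesis using v(1) by simp
qed

text \<open>Without eigenvalues every \<open>C - a\<close> would be injective, and pulling back
  along these maps would make every vector zero. Nonemptiness is what allows a bound on each
  eigenvalue to bound the supremum in \<open>spec_radius\<close>.\<close>

lemma eigenvalues_nonempty: "eigenvalues F \<noteq> {}"
proof
  assume none: "eigenvalues F = {}"
  have "v = 0" for v :: "complex ^ 'a"
  proof (rule vector_linear_factor_induct[where C = "complex_matrix F" and v = v])
    fix a v assume "complex_matrix F *v v - a *s v = 0"
    then show "v = 0"
      using none by (auto simp: eigenvalues_def)
  qed simp
  then have "(axis undefined 1 :: complex ^ 'a) = 0" .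
  then show False by (simp add: axis_eq_0_iff)
qed

lemma eigenvalue_le_spec_radius:
  assumes "z \<in> eigenvalues F"
  shows "cmod z \<le> spec_radius F"
  unfolding spec_radius_def
proof (rule cSUP_upper[OF assms])
  show "bdd_above (cmod ` eigenvalues F)"
    using eigenvalue_norm_power_le[of _ F 1] by (auto intro!: bdd_aboveI[of _ "norm F"])
qed

section \<open>Spectral radius below one and summable powers\<close>

lemma summable_of_contraction:
  fixes y w :: "nat \<Rightarrow> real"
  assumes "summable w" "\<And>t. w t \<ge> 0" "\<And>t. y t \<ge> 0" "0 \<le> a" "a < 1"
    and rec: "\<And>t. y (Suc t) \<le> a * y t + w t"
  shows "summable y"
proof (rule summableI_nonneg_bounded)
  fix n
  \<comment> \<open>Summing the recursion bounds a partial sum by \<open>a\<close> times itself plus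
    a constant; \<open>a < 1\<close> lets it be solved for.\<close>
  have "(\<Sum>t<Suc n. y t) = y 0 + (\<Sum>t<n. y (Suc t))"
    by (rule sum.lessThan_Suc_shift)
  also have "\<dots> \<le> y 0 + (\<Sum>t<n. a * y t + w t)"
    by (intro add_left_mono sum_mono rec)
  also have "\<dots> = y 0 + a * (\<Sum>t<n. y t) + (\<Sum>t<n. w t)"
    by (simp add: sum.distrib sum_distrib_left)
  also have "\<dots> \<le> y 0 + a * (\<Sum>t<n. y t) + suminf w"
    using assms by (simp add: sum_le_suminf)
  finally have "(\<Sum>t<n. y t) \<le> y 0 + a * (\<Sum>t<n. y t) + suminf w"
    using assms(3)[of n] by simp
  then have "(1 - a) * (\<Sum>t<n. y t) \<le> y 0 + suminf w"
    by (simp add: algebra_simps)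
  then show "(\<Sum>t<n. y t) \<le> (y 0 + suminf w) / (1 - a)"
    using \<open>a < 1\<close> by (simp add: field_simps)
qed (use assms in auto)

lemma summable_power2:
  fixes f :: "nat \<Rightarrow> real"
  assumes "summable f" "\<And>t. f t \<ge> 0"
  shows "summable (\<lambda>t. (f t)\<^sup>2)"
proof (rule summable_comparison_test_ev)
  have "\<forall>\<^sub>F t in sequentially. f t < 1"
    using summable_LIMSEQ_zero[OF assms(1)] by (rule order_tendstoD) simp
  then show "\<forall>\<^sub>F t in sequentially. norm ((f t)\<^sup>2) \<le> f t"
    by eventually_elim (use assms(2) in \<open>auto simp: power2_eq_square mult_left_le\<close>)
qed fact

text \<open>No Jordan form is needed: summability is pulled back along each \<open>C - a\<close>. If
  \<open>a\<close> is an eigenvalue, the iterates of \<open>v\<close> obey a recursion with factor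
  \<open>cmod a < 1\<close> and a summable perturbation; otherwise \<open>C - a\<close> is
  injective, hence bounded below, and commutes with the iteration.\<close>

lemma summable_powers_of_spec_radius:
  fixes F :: "real ^ 'n ^ 'n"
  assumes "spec_radius F < 1"
  shows "summable (\<lambda>t. norm (complex_matrix (mpow F t) *v v))"
  unfolding complex_matrix_mpow
proof (rule vector_linear_factor_induct[where C = "complex_matrix F" and v = v])
  have "((*v) (complex_matrix F) ^^ t) 0 = 0" for t
    by (induction t) auto
  then show "summable (\<lambda>t. norm (((*v) (complex_matrix F) ^^ t) 0))"
    by simp
next
  fix a v
  let ?C = "complex_matrix F"
  define w where "w = ?C *v v - a *s v"
  assume sw: "summable (\<lambda>t. norm (((*v) ?C ^^ t) (?C *v v - a *s v)))"
  have w: "((*v) ?C ^^ t) w = ((*v) ?C ^^ Suc t) v - a *s ((*v) ?C ^^ t) v" for t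
    by (induction t) (simp_all add: w_def matrix_vector_mult_diff_distrib vector_scalar_commute)
  show "summable (\<lambda>t. norm (((*v) ?C ^^ t) v))"
  proof (cases "a \<in> eigenvalues F")
    case True
    then have "cmod a < 1"
      using eigenvalue_le_spec_radius assms by fastforce
    moreover have "norm (((*v) ?C ^^ Suc t) v)
        \<le> cmod a * norm (((*v) ?C ^^ t) v) + norm (((*v) ?C ^^ t) w)" for t
    proof -
      have "((*v) ?C ^^ Suc t) v = a *s ((*v) ?C ^^ t) v + ((*v) ?C ^^ t) w"
        using w[of t] by simp
      moreover have "norm (a *s ((*v) ?C ^^ t) v) = cmod a * norm (((*v) ?C ^^ t) v)"
        by (simp add: norm_vec_def norm_mult L2_set_right_distrib)
      ultimately show ?thesis
        by (metis norm_triangle_ineq)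
    qed
    ultimately show ?thesis
      by (intro summable_of_contraction[OF sw[folded w_def], of _ "cmod a"]) (simp_all only: norm_ge_zero)
  next
    case False
    define L where "L = (\<lambda>u. ?C *v u - a *s u)"
    have "linear (\<lambda>u :: complex ^ 'n. a *s u)"
      by (intro linearI) (simp_all add: vec_eq_iff algebra_simps)
    then have lin: "linear L"
      unfolding L_def by (intro linear_compose_sub matrix_vector_mul_linear)
    have "inj L"
      unfolding linear_injective_0[OF lin] using False by (auto simp: L_def eigenvalues_def)
    then obtain b where b: "b > 0" "\<And>u. b * norm u \<le> norm (L u)"
      using linear_inj_bounded_below_pos[OF lin] by blast
    have "L (((*v) ?C ^^ t) v) = ((*v) ?C ^^ t) w" for t
      by (simp add: L_def w)
    then have "norm (((*v) ?C ^^ t) v) \<le> (1 / b) * norm (((*v) ?C ^^ t) w)" for t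
      using b(2)[of "((*v) ?C ^^ t) v"] \<open>b > 0\<close> by (simp add: field_simps)
    then show ?thesis
      using summable_comparison_test'[OF summable_mult[OF sw[folded w_def], of "1 / b"], of 0
          "\<lambda>t. norm (((*v) ?C ^^ t) v)"]
      by simp
  qed
qed

lemma spec_radius_less_1_iff: "spec_radius F < 1 \<longleftrightarrow> square_summable_powers F"
proof
  assume rho: "spec_radius F < 1"
  have col: "summable (\<lambda>t. (norm (column j (mpow F t)))\<^sup>2)" for j
  proof -
    have "norm (complex_matrix (mpow F t) *v axis j 1) = norm (column j (mpow F t))" for t
    proof -
      have "complex_matrix (mpow F t) *v axis j 1 = (\<chi> i. complex_of_real (mpow F t $ i $ j))"
        by (simp add: vec_eq_iff matrix_vector_mult_def axis_def if_distrib[of "(*) _"] cong: if_cong)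
      then show ?thesis by (simp add: norm_vec_def column_def)
    qed
    then show ?thesis
      using summable_powers_of_spec_radius[OF rho, of "axis j 1"] by (intro summable_power2) auto
  qed
  show "square_summable_powers F"
    unfolding square_summable_powers_def matrix_norm_power2(2) by (intro summable_sum col)
next
  assume "square_summable_powers F"
  then have "(\<lambda>t. (norm (mpow F t))\<^sup>2) \<longlonglongrightarrow> 0"
    unfolding square_summable_powers_def by (rule summable_LIMSEQ_zero)
  then have "\<forall>\<^sub>F t in sequentially. (norm (mpow F t))\<^sup>2 < (1 / 2)\<^sup>2"
    by (rule order_tendstoD) simp
  then have "\<forall>\<^sub>F t in sequentially. norm (mpow F t) < 1 / 2"
    by eventually_elim (rule power2_less_imp_less, simp_all)
  then obtain t0 where "\<And>t. t \<ge> t0 \<Longrightarrow> norm (mpow F t) < 1 / 2"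
    by (auto simp: eventually_sequentially)
  then obtain t where t: "norm (mpow F t) < 1 / 2" "t > 0"
    by (metis le_SucI order_refl zero_less_Suc)
  \<comment> \<open>The bound is uniform in \<open>z\<close>, which keeps the supremum strictly
    below 1.\<close>
  have "cmod z \<le> root t (1 / 2)" if "z \<in> eigenvalues F" for z
  proof -
    have "cmod z ^ t \<le> 1 / 2"
      using eigenvalue_norm_power_le[OF that, of t] t by simp
    then show ?thesis
      using t(2) real_root_le_mono[of t "cmod z ^ t" "1 / 2"] by (simp add: real_root_power_cancel)
  qed
  then have "spec_radius F \<le> root t (1 / 2)"
    unfolding spec_radius_def using eigenvalues_nonempty by (intro cSUP_least) auto
  also have "\<dots> < 1"
    using t(2) by simp
  finally show "spec_radius F < 1" .
qed

section \<open>The discrete Lyapunov operator\<close>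

text \<open>For stable \<open>F\<close> this solves \<open>X = W + F ** X ** transpose F\<close>.
  With \<open>W = mat 1\<close> it is the Gramian of the state; with \<open>F\<close> transposed and
  \<open>W\<close> the stage cost it is the cost-to-go.\<close>

definition lyap :: "real ^ 'n ^ 'n \<Rightarrow> real ^ 'n ^ 'n \<Rightarrow> real ^ 'n ^ 'n" where
  "lyap F W = (\<Sum>t. mpow F t ** W ** transpose (mpow F t))"

lemma mpow_Suc_right: "mpow F (Suc t) = mpow F t ** F"
  by (induction t) (simp_all add: matrix_mul_assoc)

lemma transpose_mpow: "transpose (mpow F t) = mpow (transpose F) t"
proof (induction t)
  case (Suc t)
  show ?case
    unfolding mpow_Suc_right[of F] by (simp add: matrix_transpose_mul Suc)
qed simp

lemma square_summable_powers_transpose: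
  "square_summable_powers (transpose F) = square_summable_powers F"
  by (simp add: square_summable_powers_def norm_transpose flip: transpose_mpow)

lemma norm_congruence_le:
  fixes M :: "real ^ 'n ^ 'm"
  shows "norm (M ** W ** transpose M) \<le> norm W * (norm M)\<^sup>2"
proof -
  have "norm (M ** W ** transpose M) \<le> norm (M ** W) * norm M"
    using norm_matrix_mult_le[of "M ** W" "transpose M"] by (simp add: norm_transpose)
  also have "\<dots> \<le> norm M * norm W * norm M"
    by (intro mult_right_mono norm_matrix_mult_le) simp
  finally show ?thesis
    by (simp add: power2_eq_square mult_ac)
qed

context
  fixes F :: "real ^ 'n ^ 'n"
  assumes F: "square_summable_powers F"
begin

lemma summable_norm_lyap: "summable (\<lambda>t. norm (mpow F t ** W ** transpose (mpow F t)))"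
  by (rule summable_comparison_test'[OF summable_mult[OF F[unfolded square_summable_powers_def]]])
     (use norm_congruence_le in auto)

lemma summable_lyap: "summable (\<lambda>t. mpow F t ** W ** transpose (mpow F t))"
  by (rule summable_norm_cancel[OF summable_norm_lyap])

lemma norm_lyap_le: "norm (lyap F W) \<le> norm W * (\<Sum>t. (norm (mpow F t))\<^sup>2)"
proof -
  have "norm (lyap F W) \<le> (\<Sum>t. norm (mpow F t ** W ** transpose (mpow F t)))"
    unfolding lyap_def by (rule summable_norm[OF summable_norm_lyap])
  also have "\<dots> \<le> (\<Sum>t. norm W * (norm (mpow F t))\<^sup>2)"
    by (intro suminf_le norm_congruence_le summable_norm_lyap
        summable_mult[OF F[unfolded square_summable_powers_def]])
  also have "\<dots> = norm W * (\<Sum>t. (norm (mpow F t))\<^sup>2)"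
    by (rule suminf_mult[OF F[unfolded square_summable_powers_def]])
  finally show ?thesis .
qed

lemma lyap_unfold: "lyap F W = W + F ** lyap F W ** transpose F"
proof -
  have "bounded_linear (\<lambda>X. F ** X ** transpose F)"
    by (rule bounded_linear_compose[OF
        bounded_bilinear.bounded_linear_left[OF bounded_bilinear_matrix_mult]
        bounded_bilinear.bounded_linear_right[OF bounded_bilinear_matrix_mult]])
  from bounded_linear.suminf[OF this summable_lyap[of W]]
  have "F ** lyap F W ** transpose F
      = (\<Sum>t. mpow F (Suc t) ** W ** transpose (mpow F (Suc t)))"
    by (simp add: lyap_def matrix_mul_assoc matrix_transpose_mul)
  also have "\<dots> = lyap F W - W"
    using suminf_split_head[OF summable_lyap[of W]] by (simp add: lyap_def)
  finally show ?thesis by simp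
qed

lemma inner_lyap_sums: "(\<lambda>t. V \<bullet> (mpow F t ** W ** transpose (mpow F t))) sums (V \<bullet> lyap F W)"
  unfolding lyap_def
  by (intro bounded_linear.sums[OF bounded_linear_inner_right] summable_sums summable_lyap)

text \<open>The term of index 0 in the Gramian is the identity, and the later terms contribute
  nonnegatively.\<close>

lemma inner_gram_ge:
  assumes X: "\<And>x. 0 \<le> x \<bullet> (X *v x)"
  shows "X \<bullet> mat 1 \<le> X \<bullet> lyap F (mat 1)"
proof -
  have "0 \<le> X \<bullet> (N ** transpose N)" for N :: "real ^ 'n ^ 'n"
    unfolding quadratic_form_inner by (intro sum_nonneg X)
  then have "(\<Sum>t\<in>{0}. X \<bullet> (mpow F t ** mat 1 ** transpose (mpow F t))) \<le> X \<bullet> lyap F (mat 1)"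
    unfolding sums_unique[OF inner_lyap_sums]
    by (intro sum_le_suminf sums_summable[OF inner_lyap_sums]) auto
  then show ?thesis by simp
qed

end

text \<open>Moving the powers across the inner product term by term exchanges the two views of the
  cost: stage cost against Gramian, and value matrix against identity.\<close>

lemma inner_lyap_adjoint:
  assumes "square_summable_powers F"
  shows "V \<bullet> lyap F W = lyap (transpose F) V \<bullet> W"
proof -
  have "V \<bullet> (mpow F t ** W ** transpose (mpow F t))
      = W \<bullet> (mpow (transpose F) t ** V ** transpose (mpow (transpose F) t))" for t
  proof -
    have "V \<bullet> (mpow F t ** W ** transpose (mpow F t)) = (mpow F t ** W) \<bullet> (V ** mpow F t)"
      by (subst inner_commute, subst matrix_inner_mult_right) simp
    also have "\<dots> = W \<bullet> (transpose (mpow F t) ** V ** mpow F t)"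
      by (simp add: matrix_inner_mult_left matrix_mul_assoc)
    finally show ?thesis
      by (simp add: transpose_mpow)
  qed
  then have "(\<lambda>t. W \<bullet> (mpow (transpose F) t ** V ** transpose (mpow (transpose F) t))) sums (V \<bullet> lyap F W)"
    using inner_lyap_sums[OF assms, of V W] by (simp only:)
  moreover have "square_summable_powers (transpose F)"
    using assms by (simp only: square_summable_powers_transpose)
  ultimately have "V \<bullet> lyap F W = W \<bullet> lyap (transpose F) V"
    by (rule sums_unique2[OF _ inner_lyap_sums])
  then show ?thesis
    by (simp only: inner_commute)
qed

lemma transpose_lyap:
  assumes "square_summable_powers F"
  shows "transpose (lyap F W) = lyap F (transpose W)"
  unfolding lyap_def
  by (subst bounded_linear.suminf[OF bounded_linear_transpose summable_lyap[OF assms]])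
     (simp add: matrix_transpose_mul matrix_mul_assoc)

lemma quadratic_form_congruence:
  fixes N :: "real ^ 'n ^ 'm"
  shows "x \<bullet> ((transpose N ** X ** N) *v x) = (N *v x) \<bullet> (X *v (N *v x))"
  by (simp add: matrix_vector_mul_assoc[symmetric] dot_lmul_matrix[symmetric]
      del: transpose_matrix_vector)

lemma quadratic_form_inner_ge:
  fixes N :: "real ^ 'p ^ 'n"
  assumes "\<And>x. c * (norm (E *v x))\<^sup>2 \<le> x \<bullet> (X *v x)"
  shows "c * (norm (E ** N))\<^sup>2 \<le> X \<bullet> (N ** transpose N)"
  unfolding quadratic_form_inner matrix_norm_power2(2) column_matrix_mult sum_distrib_left
  by (intro sum_mono assms)

text \<open>Source of every lower bound with a constant independent of the gain: coercivity of the
  cost, quadratic growth at a minimizer, and strict decrease away from stationarity.\<close>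

lemma inner_gram_ge_norm:
  assumes "square_summable_powers F" "\<And>x. c * (norm (E *v x))\<^sup>2 \<le> x \<bullet> (X *v x)" "0 \<le> c"
  shows "c * (norm E)\<^sup>2 \<le> X \<bullet> lyap F (mat 1)"
proof -
  have "c * (norm E)\<^sup>2 \<le> X \<bullet> mat 1"
    using quadratic_form_inner_ge[OF assms(2), of "mat 1"] by simp
  also have "\<dots> \<le> X \<bullet> lyap F (mat 1)"
    using assms(3) by (intro inner_gram_ge assms(1) order_trans[OF _ assms(2)]) simp
  finally show ?thesis .
qed

lemma quadratic_form_lyap_nonneg:
  assumes F: "square_summable_powers F" and W: "\<And>x. 0 \<le> x \<bullet> (W *v x)"
  shows "0 \<le> x \<bullet> (lyap (transpose F) W *v x)"
proof -
  \<comment> \<open>Every column of \<open>N\<close> is \<open>x\<close>, so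
    \<open>N ** transpose N\<close> is a positive multiple of the outer product of \<open>x\<close>
    with itself, and the inner product with it recovers the quadratic form at
    \<open>x\<close>.\<close>
  define N :: "real ^ 'a ^ 'a" where "N = (\<chi> i j. x $ i)"
  have N: "X \<bullet> (N ** transpose N) = of_nat CARD('a) * (x \<bullet> (X *v x))" for X :: "real ^ 'a ^ 'a"
    unfolding quadratic_form_inner by (simp add: N_def column_def)
  have "(\<lambda>t. (N ** transpose N) \<bullet> (mpow (transpose F) t ** W ** transpose (mpow (transpose F) t)))
      sums ((N ** transpose N) \<bullet> lyap (transpose F) W)"
    using F by (intro inner_lyap_sums) (simp add: square_summable_powers_transpose)
  moreover have "0 \<le> (N ** transpose N) \<bullet> (mpow (transpose F) t ** W ** transpose (mpow (transpose F) t))" for t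
    unfolding inner_commute[of "N ** transpose N"] N
    using quadratic_form_congruence[of x "mpow F t" W] W
    by (simp flip: transpose_mpow)
  ultimately have "0 \<le> lyap (transpose F) W \<bullet> (N ** transpose N)"
    by (subst inner_commute, subst sums_unique) (auto intro: suminf_nonneg sums_summable)
  then show ?thesis
    by (simp add: N zero_le_mult_iff)
qed

text \<open>The pairing of \<open>P\<close> with \<open>mpow F t ** transpose (mpow F t)\<close>
  stays nonnegative and drops at step \<open>t\<close> by at least \<open>q\<close> times the
  squared norm of \<open>mpow F t\<close>; the drops telescope.\<close>

lemma square_summable_powers_by_lyapunov:
  assumes P: "\<And>x. 0 \<le> x \<bullet> (P *v x)" and q: "q > 0"
    and W: "\<And>x. q * (norm x)\<^sup>2 \<le> x \<bullet> (W *v x)"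
    and le: "\<And>x. x \<bullet> ((W + transpose F ** P ** F) *v x) \<le> x \<bullet> (P *v x)"
  shows "square_summable_powers F"
  unfolding square_summable_powers_def
proof (rule summableI_nonneg_bounded)
  define a where "a t = P \<bullet> (mpow F t ** transpose (mpow F t))" for t
  have a_nonneg: "0 \<le> a t" for t
    unfolding a_def quadratic_form_inner by (intro sum_nonneg P)
  have step: "q * (norm (mpow F t))\<^sup>2 \<le> a t - a (Suc t)" for t
  proof -
    have "q * (norm (mat 1 *v x))\<^sup>2 \<le> x \<bullet> ((P - transpose F ** P ** F) *v x)" for x
      using W[of x] le[of x] by (simp add: matrix_vector_mult_add_rdistrib
          matrix_vector_mult_diff_rdistrib inner_add_right inner_diff_right)
    from quadratic_form_inner_ge[OF this, of "mpow F t"]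
    have "q * (norm (mpow F t))\<^sup>2 \<le> (P - transpose F ** P ** F) \<bullet> (mpow F t ** transpose (mpow F t))"
      by simp
    also have "\<dots> = a t - (transpose F ** P ** F) \<bullet> (mpow F t ** transpose (mpow F t))"
      by (simp add: a_def inner_diff_left)
    also have "(transpose F ** P ** F) \<bullet> (mpow F t ** transpose (mpow F t)) = a (Suc t)"
    proof -
      have "(transpose F ** P ** F) \<bullet> (mpow F t ** transpose (mpow F t))
          = (transpose F ** P) \<bullet> (mpow F t ** transpose (mpow F t) ** transpose F)"
        by (rule matrix_inner_mult_right)
      also have "\<dots> = P \<bullet> (transpose (transpose F) ** (mpow F t ** transpose (mpow F t) ** transpose F))"
        by (rule matrix_inner_mult_left)
      finally show ?thesis
        by (simp add: a_def matrix_transpose_mul matrix_mul_assoc)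
    qed
    finally show ?thesis .
  qed
  fix n
  have "(\<Sum>t<n. q * (norm (mpow F t))\<^sup>2) \<le> (\<Sum>t<n. a t - a (Suc t))"
    by (intro sum_mono step)
  also have "\<dots> \<le> a 0"
    using a_nonneg[of n] by (simp add: sum_lessThan_telescope')
  finally show "(\<Sum>t<n. (norm (mpow F t))\<^sup>2) \<le> a 0 / q"
    using q by (simp add: sum_distrib_left[symmetric] field_simps)
qed simp

section \<open>The cost of a gain\<close>

definition stage_cost :: "real ^ 'n ^ 'n \<Rightarrow> real ^ 'm ^ 'm \<Rightarrow> real ^ 'n ^ 'm \<Rightarrow> real ^ 'n ^ 'n" where
  "stage_cost Q R K = Q + transpose K ** R ** K"

definition gain_cost ::
  "real ^ 'n ^ 'n \<Rightarrow> real ^ 'm ^ 'n \<Rightarrow> real ^ 'n ^ 'n \<Rightarrow> real ^ 'm ^ 'm \<Rightarrow> real ^ 'n ^ 'm \<Rightarrow> real" where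
  "gain_cost A B Q R K = stage_cost Q R K \<bullet> lyap (A - B ** K) (mat 1)"

text \<open>Its quadratic form at \<open>x\<close> is the total cost from the initial state
  \<open>x\<close> under \<open>K\<close>, as \<open>lq_series_eq\<close> shows for stabilizing
  gains.\<close>

definition value_matrix ::
  "real ^ 'n ^ 'n \<Rightarrow> real ^ 'm ^ 'n \<Rightarrow> real ^ 'n ^ 'n \<Rightarrow> real ^ 'm ^ 'm \<Rightarrow> real ^ 'n ^ 'm \<Rightarrow> real ^ 'n ^ 'n" where
  "value_matrix A B Q R K = lyap (transpose (A - B ** K)) (stage_cost Q R K)"

lemma quadratic_form_stage_cost:
  "x \<bullet> (stage_cost Q R K *v x) = x \<bullet> (Q *v x) + (K *v x) \<bullet> (R *v (K *v x))"
  by (simp add: stage_cost_def matrix_vector_mult_add_rdistrib inner_add_right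
      quadratic_form_congruence)

lemma gain_cost_value_matrix:
  assumes "square_summable_powers (A - B ** K)"
  shows "gain_cost A B Q R K = value_matrix A B Q R K \<bullet> mat 1"
  using inner_lyap_adjoint[OF assms] by (simp add: gain_cost_def value_matrix_def)

lemma value_matrix_unfold:
  assumes "square_summable_powers (A - B ** K)"
  shows "value_matrix A B Q R K = stage_cost Q R K
    + transpose (A - B ** K) ** value_matrix A B Q R K ** (A - B ** K)"
  using lyap_unfold[of "transpose (A - B ** K)" "stage_cost Q R K"] assms
  by (simp add: value_matrix_def square_summable_powers_transpose)

lemma transpose_value_matrix:
  assumes "square_summable_powers (A - B ** K)" "transpose Q = Q" "transpose R = R"
  shows "transpose (value_matrix A B Q R K) = value_matrix A B Q R K"
proof -
  have "transpose (stage_cost Q R K) = stage_cost Q R K"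
    using assms by (simp add: stage_cost_def matrix_mult_simps)
  moreover have "square_summable_powers (transpose (A - B ** K))"
    using assms by (simp only: square_summable_powers_transpose)
  ultimately show ?thesis
    by (simp only: value_matrix_def transpose_lyap)
qed

section \<open>Comparing the costs of two gains\<close>

definition advantage ::
  "real ^ 'n ^ 'n \<Rightarrow> real ^ 'm ^ 'n \<Rightarrow> real ^ 'n ^ 'n \<Rightarrow> real ^ 'm ^ 'm \<Rightarrow> real ^ 'n ^ 'm \<Rightarrow>
   real ^ 'n ^ 'm \<Rightarrow> real ^ 'n ^ 'n" where
  "advantage A B Q R K K' =
    (let P = value_matrix A B Q R K in
     stage_cost Q R K' + transpose (A - B ** K') ** P ** (A - B ** K') - P)"

definition curvature ::
  "real ^ 'n ^ 'n \<Rightarrow> real ^ 'm ^ 'n \<Rightarrow> real ^ 'n ^ 'n \<Rightarrow> real ^ 'm ^ 'm \<Rightarrow> real ^ 'n ^ 'm \<Rightarrow> real ^ 'm ^ 'm" where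
  "curvature A B Q R K = R + transpose B ** value_matrix A B Q R K ** B"

text \<open>With \<open>P\<close> the value matrix of \<open>K\<close>, this equals
  \<open>(R + transpose B ** P ** B) ** K - transpose B ** P ** A\<close>, so its zeros satisfy the
  gain equation of the Riccati theory.\<close>

definition gain_residual ::
  "real ^ 'n ^ 'n \<Rightarrow> real ^ 'm ^ 'n \<Rightarrow> real ^ 'n ^ 'n \<Rightarrow> real ^ 'm ^ 'm \<Rightarrow> real ^ 'n ^ 'm \<Rightarrow> real ^ 'n ^ 'm" where
  "gain_residual A B Q R K = R ** K - transpose B ** value_matrix A B Q R K ** (A - B ** K)"

text \<open>Subtracting the value equation of \<open>K\<close> cancels all terms free of
  \<open>D\<close>; by symmetry of \<open>R\<close> and of the value matrix the terms linear in
  \<open>D\<close> pair up into the residual and its transpose.\<close>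

lemma advantage_eq:
  assumes K: "square_summable_powers (A - B ** K)" and Q: "transpose Q = Q" and R: "transpose R = R"
  defines "E \<equiv> gain_residual A B Q R K"
  shows "advantage A B Q R K (K + D) =
    transpose D ** curvature A B Q R K ** D + transpose D ** E + transpose E ** D"
proof -
  define P where "P = value_matrix A B Q R K"
  define F where "F = A - B ** K"
  have P: "transpose P = P"
    using transpose_value_matrix[OF K Q R] by (simp add: P_def)
  have F': "A - B ** (K + D) = F - B ** D"
    by (simp add: F_def matrix_mult_simps)
  have "advantage A B Q R K (K + D)
      = stage_cost Q R (K + D) + transpose (F - B ** D) ** P ** (F - B ** D)
        - (stage_cost Q R K + transpose F ** P ** F)"
    using value_matrix_unfold[OF K, of Q R] by (simp add: advantage_def Let_def F' P_def F_def)
  also have "\<dots> = transpose D ** (R + transpose B ** P ** B) ** D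
      + transpose D ** (R ** K - transpose B ** P ** F)
      + transpose (R ** K - transpose B ** P ** F) ** D"
    by (simp add: stage_cost_def matrix_mult_simps P R)
  finally show ?thesis
    by (simp add: E_def gain_residual_def curvature_def P_def F_def)
qed

text \<open>The advantage is the excess cost of using \<open>K'\<close> for one step and
  \<open>K\<close> ever after. Adding it up along the trajectory of \<open>K'\<close>, that is,
  pairing it with the Gramian of \<open>K'\<close>, telescopes to the full cost difference.\<close>

lemma gain_cost_diff:
  assumes K: "square_summable_powers (A - B ** K)" and K': "square_summable_powers (A - B ** K')"
  shows "gain_cost A B Q R K' - gain_cost A B Q R K
    = advantage A B Q R K K' \<bullet> lyap (A - B ** K') (mat 1)"
proof -
  define P where "P = value_matrix A B Q R K"
  define F where "F = A - B ** K'"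
  define S where "S = lyap F (mat 1)"
  have "P \<bullet> S = P \<bullet> mat 1 + P \<bullet> (F ** S ** transpose F)"
    using lyap_unfold[OF K', of "mat 1"] by (simp add: S_def F_def inner_add_right[symmetric])
  also have "P \<bullet> (F ** S ** transpose F) = (transpose F ** P ** F) \<bullet> S"
    by (subst matrix_inner_mult_right, subst matrix_inner_mult_left) (simp add: matrix_mul_assoc)
  finally show ?thesis
    using gain_cost_value_matrix[OF K, of Q R]
    by (simp add: gain_cost_def advantage_def Let_def inner_add_left inner_diff_left
        P_def F_def S_def)
qed

lemma quadratic_form_le_norm:
  fixes H :: "real ^ 'n ^ 'n"
  shows "x \<bullet> (H *v x) \<le> norm H * (norm x)\<^sup>2"
proof -
  have "x \<bullet> (H *v x) \<le> norm x * norm (H *v x)"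
    by (rule norm_cauchy_schwarz)
  also have "\<dots> \<le> norm x * (norm H * norm x)"
    by (intro mult_left_mono norm_matrix_vector_mult_le) simp
  finally show ?thesis by (simp add: power2_eq_square mult_ac)
qed

lemma value_matrix_nonneg:
  assumes "square_summable_powers (A - B ** K)"
    and "\<And>x. 0 \<le> x \<bullet> (Q *v x)" "\<And>x. 0 \<le> x \<bullet> (R *v x)"
  shows "0 \<le> x \<bullet> (value_matrix A B Q R K *v x)"
  unfolding value_matrix_def
  by (intro quadratic_form_lyap_nonneg assms(1)) (simp add: quadratic_form_stage_cost assms)

text \<open>Without residual the advantage is purely quadratic, and its curvature dominates
  \<open>R\<close> because the value matrix is positive semidefinite.\<close>

lemma gain_cost_growth:
  assumes K: "square_summable_powers (A - B ** K)" and K': "square_summable_powers (A - B ** K')"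
    and Q: "transpose Q = Q" "\<And>x. 0 \<le> x \<bullet> (Q *v x)"
    and R: "transpose R = R" "\<And>x. r * (norm x)\<^sup>2 \<le> x \<bullet> (R *v x)" and "0 \<le> r"
    and stationary: "gain_residual A B Q R K = 0"
  shows "gain_cost A B Q R K + r * (norm (K' - K))\<^sup>2 \<le> gain_cost A B Q R K'"
proof -
  have R0: "0 \<le> x \<bullet> (R *v x)" for x
    using R(2)[of x] \<open>0 \<le> r\<close> by (meson order_trans mult_nonneg_nonneg zero_le_power2)
  have adv: "advantage A B Q R K K' = transpose (K' - K) ** curvature A B Q R K ** (K' - K)"
    using advantage_eq[OF K Q(1) R(1), of "K' - K"] stationary by (simp add: matrix_mult_simps)
  have "r * (norm ((K' - K) *v x))\<^sup>2 \<le> x \<bullet> (advantage A B Q R K K' *v x)" for x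
    using R(2)[of "(K' - K) *v x"] value_matrix_nonneg[OF K Q(2) R0, of "B *v ((K' - K) *v x)"]
    unfolding adv quadratic_form_congruence curvature_def matrix_vector_mult_add_rdistrib
      inner_add_right by linarith
  from inner_gram_ge_norm[OF K' this \<open>0 \<le> r\<close>] gain_cost_diff[OF K K', of Q R]
  show ?thesis by simp
qed

lemma gain_improvement:
  assumes K: "square_summable_powers (A - B ** K)"
    and Q: "transpose Q = Q" "\<And>x. q * (norm x)\<^sup>2 \<le> x \<bullet> (Q *v x)" and "0 < q"
    and R: "transpose R = R" "\<And>x. 0 \<le> x \<bullet> (R *v x)"
    and "gain_residual A B Q R K \<noteq> 0"
  obtains K' where "square_summable_powers (A - B ** K')" "gain_cost A B Q R K' < gain_cost A B Q R K"
proof -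
  define E where "E = gain_residual A B Q R K"
  define H where "H = curvature A B Q R K"
  \<comment> \<open>The step length satisfies \<open>s * norm H \<le> 1\<close>, so the second-order
    term eats at most half of the first-order decrease; the summand 1 guards against
    \<open>H = 0\<close>.\<close>
  define s where "s = 1 / (norm H + 1)"
  have s: "s > 0" "s * norm H \<le> 1"
    by (auto simp: s_def field_simps add_pos_nonneg add_nonneg_pos)
  define K' where "K' = K + (- s) *\<^sub>R E"
  define G where "G = advantage A B Q R K K'"
  have Q0: "0 \<le> x \<bullet> (Q *v x)" for x
    using Q(2)[of x] \<open>0 < q\<close> by (meson order_trans mult_nonneg_nonneg zero_le_power2 less_imp_le)
  have G_eq: "G = (s * s) *\<^sub>R (transpose E ** H ** E)
      - (s *\<^sub>R (transpose E ** E) + s *\<^sub>R (transpose E ** E))"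
    unfolding G_def K'_def advantage_eq[OF K Q(1) R(1)] E_def[symmetric] H_def[symmetric]
    by (simp add: matrix_mult_simps)
  have quad: "x \<bullet> (G *v x) = (s * s) * ((E *v x) \<bullet> (H *v (E *v x)))
      - (s * (norm (E *v x))\<^sup>2 + s * (norm (E *v x))\<^sup>2)" for x
    unfolding G_eq matrix_vector_mult_diff_rdistrib matrix_vector_mult_add_rdistrib
      inner_diff_right inner_add_right scaleR_matrix_vector_assoc[symmetric]
      inner_scaleR_right quadratic_form_congruence
    using quadratic_form_congruence[of x E "mat 1"] by (simp add: power2_norm_eq_inner)
  have bound: "(s * s) * ((E *v x) \<bullet> (H *v (E *v x))) \<le> s * (norm (E *v x))\<^sup>2" for x
  proof -
    have "(s * s) * ((E *v x) \<bullet> (H *v (E *v x))) \<le> (s * s) * (norm H * (norm (E *v x))\<^sup>2)"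
      by (intro mult_left_mono quadratic_form_le_norm) simp
    also have "\<dots> = (s * norm H) * (s * (norm (E *v x))\<^sup>2)"
      by simp
    also have "\<dots> \<le> 1 * (s * (norm (E *v x))\<^sup>2)"
      using s by (intro mult_right_mono) auto
    finally show ?thesis by simp
  qed
  have G: "s * (norm (E *v x))\<^sup>2 \<le> x \<bullet> ((- G) *v x)" for x
    using quad[of x] bound[of x] matrix_vector_mult_diff_rdistrib[of 0 G x] by simp
  \<comment> \<open>The value matrix of the old gain is a Lyapunov function for the new one, because
    the advantage \<open>G\<close> is negative semidefinite.\<close>
  have K': "square_summable_powers (A - B ** K')"
  proof (rule square_summable_powers_by_lyapunov[of "value_matrix A B Q R K" q "stage_cost Q R K'"])
    fix x
    show "0 \<le> x \<bullet> (value_matrix A B Q R K *v x)"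
      by (rule value_matrix_nonneg[OF K Q0 R(2)])
    show "q * (norm x)\<^sup>2 \<le> x \<bullet> (stage_cost Q R K' *v x)"
      using Q(2)[of x] R(2)[of "K' *v x"] by (simp add: quadratic_form_stage_cost)
    have "stage_cost Q R K' + transpose (A - B ** K') ** value_matrix A B Q R K ** (A - B ** K')
        = value_matrix A B Q R K - (- G)"
      by (simp add: G_def advantage_def Let_def)
    moreover have "0 \<le> x \<bullet> ((- G) *v x)"
      using G[of x] s(1) by (meson order_trans mult_nonneg_nonneg zero_le_power2 less_imp_le)
    ultimately show "x \<bullet> ((stage_cost Q R K' + transpose (A - B ** K') ** value_matrix A B Q R K ** (A - B ** K')) *v x)
        \<le> x \<bullet> (value_matrix A B Q R K *v x)"
      by (simp only: matrix_vector_mult_diff_rdistrib inner_diff_right)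
  qed fact
  have "0 < s * (norm E)\<^sup>2"
    using s(1) assms(7) by (simp add: E_def)
  also have "\<dots> \<le> (- G) \<bullet> lyap (A - B ** K') (mat 1)"
    using s(1) by (intro inner_gram_ge_norm[OF K' G]) simp
  also have "\<dots> = gain_cost A B Q R K - gain_cost A B Q R K'"
    using gain_cost_diff[OF K K', of Q R] by (simp add: G_def)
  finally show ?thesis
    by (intro that[OF K']) simp
qed

section \<open>Coercivity of the cost and existence of an optimal gain\<close>

lemma gain_cost_ge_partial_sum:
  assumes K: "square_summable_powers (A - B ** K)"
    and Q: "\<And>x. 0 \<le> x \<bullet> (Q *v x)" and R: "\<And>x. 0 \<le> x \<bullet> (R *v x)"
  shows "(\<Sum>t<T. stage_cost Q R K \<bullet> (mpow (A - B ** K) t ** transpose (mpow (A - B ** K) t)))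
    \<le> gain_cost A B Q R K"
proof -
  let ?W = "stage_cost Q R K" and ?F = "A - B ** K"
  have sums: "(\<lambda>t. ?W \<bullet> (mpow ?F t ** transpose (mpow ?F t))) sums gain_cost A B Q R K"
    using inner_lyap_sums[OF K, of ?W "mat 1"] by (simp add: gain_cost_def)
  have "0 \<le> ?W \<bullet> (N ** transpose N)" for N :: "real ^ 'a ^ 'a"
    unfolding quadratic_form_inner quadratic_form_stage_cost
    by (intro sum_nonneg add_nonneg_nonneg Q R)
  then show ?thesis
    unfolding sums_unique[OF sums] by (intro sum_le_suminf sums_summable[OF sums]) auto
qed

lemma gain_cost_nonneg:
  assumes "square_summable_powers (A - B ** K)"
    and "\<And>x. 0 \<le> x \<bullet> (Q *v x)" "\<And>x. 0 \<le> x \<bullet> (R *v x)"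
  shows "0 \<le> gain_cost A B Q R K"
  using gain_cost_ge_partial_sum[OF assms, of 0] by simp

lemma gain_cost_ge_norm_gain:
  assumes K: "square_summable_powers (A - B ** K)"
    and Q: "\<And>x. 0 \<le> x \<bullet> (Q *v x)" and R: "\<And>x. r * (norm x)\<^sup>2 \<le> x \<bullet> (R *v x)" and "0 \<le> r"
  shows "r * (norm K)\<^sup>2 \<le> gain_cost A B Q R K"
  unfolding gain_cost_def
proof (rule inner_gram_ge_norm[OF K _ \<open>0 \<le> r\<close>])
  show "r * (norm (K *v x))\<^sup>2 \<le> x \<bullet> (stage_cost Q R K *v x)" for x
    using Q[of x] R[of "K *v x"] by (simp add: quadratic_form_stage_cost)
qed

text \<open>Finite sums make this bound available before stability is known, so that bounded partial
  costs can prove stability.\<close>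

lemma sum_norm_mpow_le:
  assumes Q: "\<And>x. q * (norm x)\<^sup>2 \<le> x \<bullet> (Q *v x)" and R: "\<And>x. 0 \<le> x \<bullet> (R *v x)"
  shows "q * (\<Sum>t<T. (norm (mpow F t))\<^sup>2)
    \<le> (\<Sum>t<T. stage_cost Q R K \<bullet> (mpow F t ** transpose (mpow F t)))"
proof -
  have "q * (norm (mat 1 *v x))\<^sup>2 \<le> x \<bullet> (stage_cost Q R K *v x)" for x
    using Q[of x] R[of "K *v x"] by (simp add: quadratic_form_stage_cost)
  from quadratic_form_inner_ge[OF this] show ?thesis
    unfolding sum_distrib_left by (intro sum_mono) simp
qed

lemma suminf_norm_mpow_le:
  assumes K: "square_summable_powers (A - B ** K)"
    and Q: "\<And>x. q * (norm x)\<^sup>2 \<le> x \<bullet> (Q *v x)" and "0 < q" and R: "\<And>x. 0 \<le> x \<bullet> (R *v x)"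
  shows "(\<Sum>t. (norm (mpow (A - B ** K) t))\<^sup>2) \<le> gain_cost A B Q R K / q"
proof (rule suminf_le_const)
  have Q0: "0 \<le> x \<bullet> (Q *v x)" for x
    using Q[of x] \<open>0 < q\<close> by (meson order_trans mult_nonneg_nonneg zero_le_power2 less_imp_le)
  fix T
  show "(\<Sum>t<T. (norm (mpow (A - B ** K) t))\<^sup>2) \<le> gain_cost A B Q R K / q"
    using order_trans[OF sum_norm_mpow_le[OF Q R] gain_cost_ge_partial_sum[OF K Q0 R]] \<open>0 < q\<close>
    by (simp add: field_simps)
qed (use K in \<open>simp add: square_summable_powers_def\<close>)

lemma gain_cost_le_by_partial_sums:
  assumes Q: "\<And>x. q * (norm x)\<^sup>2 \<le> x \<bullet> (Q *v x)" and "0 < q" and R: "\<And>x. 0 \<le> x \<bullet> (R *v x)"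
    and le: "\<And>T. (\<Sum>t<T. stage_cost Q R K \<bullet> (mpow (A - B ** K) t ** transpose (mpow (A - B ** K) t))) \<le> m"
  shows "square_summable_powers (A - B ** K)" and "gain_cost A B Q R K \<le> m"
proof -
  show K: "square_summable_powers (A - B ** K)"
    unfolding square_summable_powers_def
  proof (rule summableI_nonneg_bounded)
    show "(\<Sum>t<n. (norm (mpow (A - B ** K) t))\<^sup>2) \<le> m / q" for n
      using order_trans[OF sum_norm_mpow_le[OF Q R] le] \<open>0 < q\<close> by (simp add: field_simps)
  qed simp
  show "gain_cost A B Q R K \<le> m"
    using inner_lyap_sums[OF K, of "stage_cost Q R K" "mat 1"]
    by (intro LIMSEQ_le_const2[of _ "gain_cost A B Q R K"])
       (auto simp: gain_cost_def sums_def intro: le)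
qed

lemma tendsto_mpow: "(f \<longlongrightarrow> F) net \<Longrightarrow> ((\<lambda>x. mpow (f x) t) \<longlongrightarrow> mpow F t) net"
  by (induction t) (auto intro: bounded_bilinear.tendsto[OF bounded_bilinear_matrix_mult])

text \<open>The partial sums of the cost are continuous, so the cost is lower semicontinuous, and a bound
  on them passes stability to the limit of a minimizing sequence.\<close>
lemma minimal_gain_exists:
  assumes Q: "\<And>x. q * (norm x)\<^sup>2 \<le> x \<bullet> (Q *v x)" and q: "0 < q"
    and R: "\<And>x. r * (norm x)\<^sup>2 \<le> x \<bullet> (R *v x)" and r: "0 < r"
    and K0: "square_summable_powers (A - B ** K0)"
  obtains K where "square_summable_powers (A - B ** K)"
    "\<And>K'. square_summable_powers (A - B ** K') \<Longrightarrow> gain_cost A B Q R K \<le> gain_cost A B Q R K'"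
proof -
  define S where "S = {K. square_summable_powers (A - B ** K)}"
  define J where "J = gain_cost A B Q R"
  define pc where "pc T K =
    (\<Sum>t<T. stage_cost Q R K \<bullet> (mpow (A - B ** K) t ** transpose (mpow (A - B ** K) t)))" for T K
  define m where "m = (INF K\<in>S. J K)"
  have Q0: "0 \<le> x \<bullet> (Q *v x)" for x
    using Q[of x] q by (meson order_trans mult_nonneg_nonneg zero_le_power2 less_imp_le)
  have R0: "0 \<le> x \<bullet> (R *v x)" for x
    using R[of x] r by (meson order_trans mult_nonneg_nonneg zero_le_power2 less_imp_le)
  have bdd: "bdd_below (J ` S)"
    using gain_cost_nonneg[OF _ Q0 R0] by (intro bdd_belowI2[of _ 0]) (auto simp: S_def J_def)
  have "\<exists>K\<in>S. J K < m + 1 / Suc n" for n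
    using cInf_lessD[of "J ` S" "m + 1 / Suc n"] K0 by (auto simp: m_def S_def)
  then obtain X where X: "\<And>n. X n \<in> S" "\<And>n. J (X n) < m + 1 / Suc n"
    by metis
  \<comment> \<open>Coercivity in the gain keeps the minimizing sequence bounded; all its costs are
    at most \<open>m + 1\<close>.\<close>
  have "norm (X n) \<le> sqrt ((m + 1) / r)" for n
  proof (rule real_le_rsqrt)
    have "r * (norm (X n))\<^sup>2 \<le> J (X n)"
      unfolding J_def using X(1)[of n] r by (intro gain_cost_ge_norm_gain Q0 R) (auto simp: S_def)
    moreover have "1 / real (Suc n) \<le> 1" by simp
    ultimately have "r * (norm (X n))\<^sup>2 \<le> m + 1"
      using X(2)[of n] by linarith
    then show "(norm (X n))\<^sup>2 \<le> (m + 1) / r"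
      using r by (simp add: field_simps)
  qed
  then have "bounded (range X)"
    by (auto simp: bounded_iff)
  then obtain K \<phi> where \<phi>: "strict_mono \<phi>" and lim: "(X \<circ> \<phi>) \<longlonglongrightarrow> K"
    using bounded_imp_convergent_subsequence by blast
  have pc_lim: "(\<lambda>n. pc T (X (\<phi> n))) \<longlonglongrightarrow> pc T K" for T
  proof -
    have lim': "(\<lambda>n. X (\<phi> n)) \<longlonglongrightarrow> K"
      using lim by (simp add: o_def)
    note mult = bounded_bilinear.tendsto[OF bounded_bilinear_matrix_mult]
    note trans = bounded_linear.tendsto[OF bounded_linear_transpose]
    show ?thesis
      unfolding pc_def stage_cost_def
      by (intro tendsto_sum tendsto_inner tendsto_add mult trans tendsto_mpow tendsto_diff
          tendsto_const lim')
  qed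
  have m_lim: "(\<lambda>n. m + 1 / Suc (\<phi> n)) \<longlonglongrightarrow> m"
    using LIMSEQ_subseq_LIMSEQ[OF LIMSEQ_inverse_real_of_nat_add \<phi>, of m]
    by (simp add: o_def inverse_eq_divide)
  have "pc T K \<le> m" for T
  proof (rule LIMSEQ_le[OF pc_lim m_lim], intro exI allI impI)
    fix n
    show "pc T (X (\<phi> n)) \<le> m + 1 / Suc (\<phi> n)"
      using gain_cost_ge_partial_sum[OF _ Q0 R0, of A B "X (\<phi> n)" T] X[of "\<phi> n"]
      by (simp add: S_def J_def pc_def)
  qed
  from gain_cost_le_by_partial_sums[OF Q q R0 this[unfolded pc_def]]
  show ?thesis
    using cINF_lower[OF bdd] by (intro that[of K]) (force simp: S_def J_def m_def)+
qed

lemma optimal_gain_exists: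
  assumes "transpose Q = Q" and Q: "\<And>x. q * (norm x)\<^sup>2 \<le> x \<bullet> (Q *v x)" and q: "0 < q"
    and "transpose R = R" and R: "\<And>x. r * (norm x)\<^sup>2 \<le> x \<bullet> (R *v x)" and r: "0 < r"
    and K0: "square_summable_powers (A - B ** K0)"
  obtains K where "square_summable_powers (A - B ** K)"
    "\<And>K'. square_summable_powers (A - B ** K')
      \<Longrightarrow> gain_cost A B Q R K + r * (norm (K' - K))\<^sup>2 \<le> gain_cost A B Q R K'"
proof -
  have Q0: "0 \<le> x \<bullet> (Q *v x)" for x
    using Q[of x] q by (meson order_trans mult_nonneg_nonneg zero_le_power2 less_imp_le)
  have R0: "0 \<le> x \<bullet> (R *v x)" for x
    using R[of x] r by (meson order_trans mult_nonneg_nonneg zero_le_power2 less_imp_le)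
  obtain K where K: "square_summable_powers (A - B ** K)"
    and min: "\<And>K'. square_summable_powers (A - B ** K') \<Longrightarrow> gain_cost A B Q R K \<le> gain_cost A B Q R K'"
    using minimal_gain_exists[OF Q q R r K0] by blast
  have "gain_residual A B Q R K = 0"
    using gain_improvement[OF K assms(1) Q q assms(4) R0] min by (metis not_le)
  then show ?thesis
    using gain_cost_growth[OF K _ assms(1) Q0 assms(4) R] r by (intro that[OF K]) auto
qed

text \<open>The cost difference is the advantage paired with a Gramian bounded through
  \<open>s\<close>. The advantage has a linear and a quadratic part in \<open>K' - K\<close>, and
  the quadratic one becomes linear because the gains differ by at most \<open>2 * k\<close>.\<close>

lemma gain_cost_lipschitz:
  fixes A :: "real ^ 'n ^ 'n" and B :: "real ^ 'm ^ 'n"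
  assumes Q: "transpose Q = Q" and R: "transpose R = R" and "0 \<le> k" "0 \<le> s"
  obtains G where "0 \<le> G"
    "\<And>K K'. \<lbrakk>square_summable_powers (A - B ** K); square_summable_powers (A - B ** K');
      norm K \<le> k; norm K' \<le> k; (\<Sum>t. (norm (mpow (A - B ** K) t))\<^sup>2) \<le> s;
      (\<Sum>t. (norm (mpow (A - B ** K') t))\<^sup>2) \<le> s\<rbrakk>
      \<Longrightarrow> \<bar>gain_cost A B Q R K' - gain_cost A B Q R K\<bar> \<le> G * norm (K' - K)"
proof -
  \<comment> \<open>\<open>w\<close>, \<open>h\<close> and \<open>e\<close> bound the norms of the
    stage cost, the curvature and the residual; \<open>w * s\<close> bounds the value
    matrix.\<close>
  define w where "w = norm Q + k * norm R * k"
  define h where "h = norm R + norm B * (w * s) * norm B"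
  define e where "e = norm R * k + norm B * (w * s) * (norm A + norm B * k)"
  define G where "G = (2 * k * h + 2 * e) * (norm (mat 1 :: real ^ 'n ^ 'n) * s)"
  have nn: "0 \<le> w" "0 \<le> h" "0 \<le> e"
    using assms by (auto simp: w_def h_def e_def)
  have nm: "norm (M ** N) \<le> a * b" if "norm M \<le> a" "norm N \<le> b"
    for M :: "real ^ 'i ^ 'j" and N :: "real ^ 'l ^ 'i" and a b
  proof -
    have "0 \<le> a" using that(1) norm_ge_zero order_trans by blast
    then have "norm M * norm N \<le> a * b"
      using that by (intro mult_mono) auto
    then show ?thesis
      using norm_matrix_mult_le[of M N] by linarith
  qed
  have nt: "norm (transpose M) \<le> a" if "norm M \<le> a" for M :: "real ^ 'i ^ 'j" and a
    using that by (simp add: norm_transpose)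
  show ?thesis
  proof (rule that[of G])
    show "0 \<le> G"
      using assms nn by (auto simp: G_def)
    fix K K'
    assume K: "square_summable_powers (A - B ** K)" and K': "square_summable_powers (A - B ** K')"
      and k: "norm K \<le> k" "norm K' \<le> k"
      and s: "(\<Sum>t. (norm (mpow (A - B ** K) t))\<^sup>2) \<le> s" "(\<Sum>t. (norm (mpow (A - B ** K') t))\<^sup>2) \<le> s"
    define d where "d = norm (K' - K)"
    have d: "d \<le> 2 * k" "0 \<le> d"
      using norm_triangle_ineq4[of K' K] k by (auto simp: d_def)
    let ?P = "value_matrix A B Q R K" and ?H = "curvature A B Q R K" and ?E = "gain_residual A B Q R K"
    have "norm (stage_cost Q R K) \<le> w"
      unfolding stage_cost_def w_def
      by (intro norm_triangle_le add_mono nm nt k order_refl)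
    then have "norm (stage_cost Q R K) * (\<Sum>t. (norm (mpow (transpose (A - B ** K)) t))\<^sup>2) \<le> w * s"
      using s(1) nn(1) by (intro mult_mono)
        (auto simp: norm_transpose transpose_mpow[symmetric] intro!: suminf_nonneg
          K[unfolded square_summable_powers_def])
    then have P: "norm ?P \<le> w * s"
      using norm_lyap_le[OF square_summable_powers_transpose[THEN iffD2, OF K], of "stage_cost Q R K"]
      unfolding value_matrix_def by linarith
    have H: "norm ?H \<le> h"
      unfolding curvature_def h_def by (intro norm_triangle_le add_mono nm nt P order_refl)
    have E: "norm ?E \<le> e"
      unfolding gain_residual_def e_def
      by (intro norm_triangle_le_diff add_mono nm nt P k order_refl)
    have "advantage A B Q R K K' = transpose (K' - K) ** ?H ** (K' - K)
        + transpose (K' - K) ** ?E + transpose ?E ** (K' - K)"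
      using advantage_eq[OF K Q R, of "K' - K"] by simp
    then have "norm (advantage A B Q R K K') \<le> d * h * d + d * e + e * d"
      by (simp only:) (intro norm_triangle_le add_mono nm nt H E, auto simp: d_def)
    also have "\<dots> \<le> (2 * k * h + 2 * e) * d"
      using mult_right_mono[OF d(1), of "h * d"] nn d(2) by (simp add: algebra_simps)
    finally have "norm (advantage A B Q R K K') * norm (lyap (A - B ** K') (mat 1))
        \<le> (2 * k * h + 2 * e) * d * (norm (mat 1 :: real ^ 'n ^ 'n) * s)"
    proof (rule mult_mono)
      show "norm (lyap (A - B ** K') (mat 1)) \<le> norm (mat 1 :: real ^ 'n ^ 'n) * s"
        using order_trans[OF norm_lyap_le[OF K', of "mat 1"] mult_left_mono[OF s(2) norm_ge_zero]] .
    qed (use assms nn d in auto)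
    then show "\<bar>gain_cost A B Q R K' - gain_cost A B Q R K\<bar> \<le> G * norm (K' - K)"
      unfolding gain_cost_diff[OF K K'] G_def d_def[symmetric]
      using Cauchy_Schwarz_ineq2[of "advantage A B Q R K K'" "lyap (A - B ** K') (mat 1)"]
      by (simp add: mult_ac)
  qed
qed

section \<open>The expected cost\<close>

lemma stabilizing_iff: "K \<in> stabilizing A B \<longleftrightarrow> square_summable_powers (A - B ** K)"
  by (simp add: stabilizing_def spec_radius_less_1_iff)

lemma closed_loop_eq_mpow: "closed_loop A B K x t = mpow (A - B ** K) t *v x"
proof (induction t)
  case (Suc t)
  have "B *v (- y) = - (B *v y)" for y
    using matrix_vector_mult_diff_distrib[of B 0 y] by simp
  with Suc show ?case
    by (simp add: matrix_vector_mul_assoc[symmetric] matrix_vector_mult_diff_rdistrib)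
qed simp

text \<open>Linearity in the outer product of \<open>x\<close> with itself is why the expected cost
  depends on the initial state only through its second moments.\<close>

lemma quadratic_form_eq_inner:
  fixes P :: "real ^ 'n ^ 'n"
  shows "x \<bullet> (P *v x) = P \<bullet> (\<chi> i j. x $ i * x $ j)"
  by (simp add: inner_vec_def matrix_vector_mult_def sum_distrib_left mult_ac)

text \<open>Moving the powers from the state onto the stage cost turns the cost series into the
  Lyapunov series of the transposed closed-loop matrix.\<close>

lemma lq_series_eq:
  assumes K: "square_summable_powers (A - B ** K)"
  shows "(\<Sum>t. let x = closed_loop A B K x t; u = - (K *v x) in x \<bullet> (Q *v x) + u \<bullet> (R *v u))
    = x \<bullet> (value_matrix A B Q R K *v x)"
proof -
  let ?F = "A - B ** K" and ?X = "\<chi> i j. x $ i * x $ j"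
  have term_eq: "(let x = closed_loop A B K x t; u = - (K *v x) in x \<bullet> (Q *v x) + u \<bullet> (R *v u))
      = ?X \<bullet> (mpow (transpose ?F) t ** stage_cost Q R K ** transpose (mpow (transpose ?F) t))" for t
  proof -
    have neg: "R *v (- y) = - (R *v y)" for y
      using matrix_vector_mult_diff_distrib[of R 0 y] by simp
    let ?y = "mpow ?F t *v x"
    have "(let x = closed_loop A B K x t; u = - (K *v x) in x \<bullet> (Q *v x) + u \<bullet> (R *v u))
        = ?y \<bullet> (stage_cost Q R K *v ?y)"
      by (simp add: Let_def closed_loop_eq_mpow quadratic_form_stage_cost neg)
    also have "\<dots> = x \<bullet> ((transpose (mpow ?F t) ** stage_cost Q R K ** mpow ?F t) *v x)"
      by (simp only: quadratic_form_congruence)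
    also have "\<dots> = ?X \<bullet> (mpow (transpose ?F) t ** stage_cost Q R K ** transpose (mpow (transpose ?F) t))"
      by (simp only: quadratic_form_eq_inner inner_commute[of ?X] transpose_mpow transpose_transpose)
    finally show ?thesis .
  qed
  have "(\<Sum>t. let x = closed_loop A B K x t; u = - (K *v x) in x \<bullet> (Q *v x) + u \<bullet> (R *v u))
      = ?X \<bullet> value_matrix A B Q R K"
    unfolding term_eq value_matrix_def
    by (intro sums_unique[symmetric] inner_lyap_sums square_summable_powers_transpose[THEN iffD2, OF K])
  then show ?thesis
    by (simp only: quadratic_form_eq_inner inner_commute[of ?X])
qed

lemma lq_cost_eq_gain_cost:
  fixes x0 :: "'a \<Rightarrow> real ^ 'n"
  assumes cov: "(\<integral>\<omega>. (\<chi> i j. x0 \<omega> $ i * x0 \<omega> $ j) \<partial>M) = (mat 1 :: real ^ 'n ^ 'n)"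
    and K: "K \<in> stabilizing A B"
  shows "lq_cost M x0 A B Q R K = gain_cost A B Q R K"
proof -
  have K: "square_summable_powers (A - B ** K)"
    using K by (simp add: stabilizing_iff)
  \<comment> \<open>The integral of a non-integrable function is 0 by convention, so a second-moment
    matrix equal to the identity already entails integrability.\<close>
  have "integrable M (\<lambda>\<omega>. \<chi> i j. x0 \<omega> $ i * x0 \<omega> $ j)"
  proof (rule ccontr)
    assume "\<not> ?thesis"
    then have "(mat 1 :: real ^ 'n ^ 'n) = 0"
      using not_integrable_integral_eq[of M "\<lambda>\<omega>. \<chi> i j. x0 \<omega> $ i * x0 \<omega> $ j"] cov by simp
    then have "(mat 1 :: real ^ 'n ^ 'n) $ undefined $ undefined = 0"
      by simp
    then show False
      by (simp add: mat_def)
  qed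
  then have "(\<integral>\<omega>. value_matrix A B Q R K \<bullet> (\<chi> i j. x0 \<omega> $ i * x0 \<omega> $ j) \<partial>M)
      = value_matrix A B Q R K \<bullet> mat 1"
    using cov by (subst integral_inner_right) auto
  then show ?thesis
    unfolding lq_cost_def lq_series_eq[OF K] gain_cost_value_matrix[OF K]
    by (simp only: quadratic_form_eq_inner)
qed

text \<open>Linearity in the weights makes the Lagrangian, up to a constant, the cost of a single
  problem with combined weights.\<close>

lemma gain_cost_add:
  "gain_cost A B (Q + Q') (R + R') K = gain_cost A B Q R K + gain_cost A B Q' R' K"
  by (simp add: gain_cost_def stage_cost_def matrix_mult_simps inner_add_left)

lemma gain_cost_scaleR: "gain_cost A B (a *\<^sub>R Q) (a *\<^sub>R R) K = a * gain_cost A B Q R K"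
  by (simp add: gain_cost_def stage_cost_def matrix_mult_simps inner_add_left algebra_simps)

lemma gain_cost_sum:
  assumes "finite I"
  shows "gain_cost A B (\<Sum>i\<in>I. Q i) (\<Sum>i\<in>I. R i) K = (\<Sum>i\<in>I. gain_cost A B (Q i) (R i) K)"
  using assms
proof (induction I)
  case empty
  then show ?case
    by (simp add: gain_cost_def stage_cost_def matrix_mult_simps)
qed (simp add: gain_cost_add)

section \<open>Gradients of dual functions with quadratic growth\<close>

text \<open>Abstract in the objective \<open>f\<close>, the constraints \<open>g\<close> and the
  minimizer map \<open>\<kappa>\<close>. The hypothesis controls \<open>g\<close> only along
  minimizers; quadratic growth converts this into control by the multipliers.\<close>

lemma orthant_gradient_lipschitz_on_bounded:
  fixes f :: "'b :: real_normed_vector \<Rightarrow> real" and g :: "'b \<Rightarrow> real ^ 'k" and D :: "real ^ 'k \<Rightarrow> real"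
  assumes S: "\<And>l. l \<in> nonneg_orthant \<Longrightarrow> \<kappa> l \<in> S"
    and D: "\<And>l. l \<in> nonneg_orthant \<Longrightarrow> D l = f (\<kappa> l) + l \<bullet> g (\<kappa> l)"
    and growth: "\<And>l K. l \<in> nonneg_orthant \<Longrightarrow> K \<in> S
      \<Longrightarrow> D l + r * (norm (K - \<kappa> l))\<^sup>2 \<le> f K + l \<bullet> g K" and "0 < r"
    and lipschitz: "\<And>\<rho>. \<exists>G\<ge>0. \<forall>l\<in>nonneg_orthant. \<forall>l'\<in>nonneg_orthant. norm l \<le> \<rho> \<longrightarrow> norm l' \<le> \<rho>
      \<longrightarrow> norm (g (\<kappa> l') - g (\<kappa> l)) \<le> G * norm (\<kappa> l' - \<kappa> l)"
  obtains \<mu> where "0 < \<mu>"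
    "\<And>l l'. \<lbrakk>l \<in> nonneg_orthant; l' \<in> nonneg_orthant; norm l \<le> \<rho>; norm l' \<le> \<rho>\<rbrakk>
      \<Longrightarrow> norm (orthant_gradient D l' - orthant_gradient D l) \<le> \<mu> * norm (l' - l)"
proof -
  \<comment> \<open>Growth at \<open>l\<close> tested with the minimizer for \<open>l'\<close>,
    added to growth at \<open>l'\<close> tested with the minimizer for \<open>l\<close>; the values
    of \<open>f\<close> cancel.\<close>
  have gap: "2 * r * (norm (\<kappa> l' - \<kappa> l))\<^sup>2 \<le> norm (l' - l) * norm (g (\<kappa> l') - g (\<kappa> l))"
    if l: "l \<in> nonneg_orthant" and l': "l' \<in> nonneg_orthant" for l l'
  proof -
    have "2 * r * (norm (\<kappa> l' - \<kappa> l))\<^sup>2 \<le> (l - l') \<bullet> (g (\<kappa> l') - g (\<kappa> l))"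
      using growth[OF l S[OF l']] growth[OF l' S[OF l]] D[OF l] D[OF l']
      by (simp add: inner_diff_left inner_diff_right norm_minus_commute)
    also have "\<dots> \<le> norm (l' - l) * norm (g (\<kappa> l') - g (\<kappa> l))"
      using norm_cauchy_schwarz[of "l - l'"] by (simp add: norm_minus_commute)
    finally show ?thesis .
  qed
  have lip: "\<exists>\<mu>>0. \<forall>l\<in>nonneg_orthant. \<forall>l'\<in>nonneg_orthant. norm l \<le> \<rho> \<longrightarrow> norm l' \<le> \<rho>
      \<longrightarrow> norm (g (\<kappa> l') - g (\<kappa> l)) \<le> \<mu> * norm (l' - l)" for \<rho>
  proof -
    obtain G where "0 \<le> G" and G: "\<And>l l'. \<lbrakk>l \<in> nonneg_orthant; l' \<in> nonneg_orthant; norm l \<le> \<rho>; norm l' \<le> \<rho>\<rbrakk>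
      \<Longrightarrow> norm (g (\<kappa> l') - g (\<kappa> l)) \<le> G * norm (\<kappa> l' - \<kappa> l)"
      using lipschitz[of \<rho>] by blast
    \<comment> \<open>\<open>G / (2 * r)\<close> is the Lipschitz constant of
      \<open>\<kappa>\<close>, obtained by cancelling one factor \<open>d\<close> in the gap; the
      summand 1 only makes the constant positive.\<close>
    have "norm (g (\<kappa> l') - g (\<kappa> l)) \<le> (G * (G / (2 * r)) + 1) * norm (l' - l)"
      if l: "l \<in> nonneg_orthant" "l' \<in> nonneg_orthant" "norm l \<le> \<rho>" "norm l' \<le> \<rho>" for l l'
    proof -
      define d where "d = norm (\<kappa> l' - \<kappa> l)"
      have "2 * r * d\<^sup>2 \<le> norm (l' - l) * (G * d)"
        using order_trans[OF gap[OF l(1,2)] mult_left_mono[OF G[OF l]]] by (simp add: d_def)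
      then have "2 * r * d \<le> norm (l' - l) * G"
        using mult_right_le_imp_le[of "2 * r * d" d "norm (l' - l) * G"] \<open>0 < r\<close> \<open>0 \<le> G\<close>
        by (cases "d = 0") (auto simp: d_def power2_eq_square mult_ac)
      then have "d \<le> G / (2 * r) * norm (l' - l)"
        using \<open>0 < r\<close> by (simp add: field_simps)
      then have "G * d \<le> G * (G / (2 * r) * norm (l' - l))"
        using \<open>0 \<le> G\<close> by (rule mult_left_mono)
      then show ?thesis
        using G[OF l] norm_ge_zero[of "l' - l"] unfolding d_def distrib_right mult_1_left mult.assoc
        by linarith
    qed
    then show ?thesis
      using \<open>0 \<le> G\<close> \<open>0 < r\<close>
      by (intro exI[of _ "G * (G / (2 * r)) + 1"] conjI add_nonneg_pos mult_nonneg_nonneg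
          divide_nonneg_pos) auto
  qed
  have gradient: "orthant_gradient D l = g (\<kappa> l)" if l: "l \<in> nonneg_orthant" for l
  proof (rule orthant_gradient_eqI[OF l])
    \<comment> \<open>The radius \<open>norm l + 1\<close> covers the unit ball around
      \<open>l\<close>, which suffices for a derivative at \<open>l\<close>.\<close>
    obtain \<mu> where "0 < \<mu>" and \<mu>: "\<And>l'. l' \<in> nonneg_orthant \<Longrightarrow> norm l' \<le> norm l + 1
        \<Longrightarrow> norm (g (\<kappa> l') - g (\<kappa> l)) \<le> \<mu> * norm (l' - l)"
      using lip[of "norm l + 1"] l by force
    show "(D has_derivative (\<lambda>h. g (\<kappa> l) \<bullet> h)) (at l within nonneg_orthant)"
      unfolding has_derivative_within_alt
    proof (intro conjI allI impI)
      show "bounded_linear (\<lambda>h. g (\<kappa> l) \<bullet> h)"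
        by (rule bounded_linear_inner_right)
      fix e :: real
      assume "0 < e"
      show "\<exists>d>0. \<forall>l'\<in>nonneg_orthant. norm (l' - l) < d \<longrightarrow>
          norm (D l' - D l - g (\<kappa> l) \<bullet> (l' - l)) \<le> e * norm (l' - l)"
      proof (intro exI[of _ "min 1 (e / \<mu>)"] conjI ballI impI)
        show "0 < min 1 (e / \<mu>)"
          using \<open>0 < e\<close> \<open>0 < \<mu>\<close> by simp
        fix l'
        assume l': "l' \<in> nonneg_orthant" and "norm (l' - l) < min 1 (e / \<mu>)"
        then have near: "norm (l' - l) < 1" "\<mu> * norm (l' - l) \<le> e"
          using \<open>0 < \<mu>\<close> by (auto simp: field_simps)
        have "norm l' \<le> norm l + 1"
          using near(1) norm_triangle_sub[of l' l] by simp
        note \<mu>' = \<mu>[OF l' this]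
        \<comment> \<open>\<open>D\<close> is a minimum of functions affine in the multiplier, so
          the minimizer for one multiplier bounds \<open>D\<close> from above at every
          other.\<close>
        have upper: "D m' \<le> f (\<kappa> m) + m' \<bullet> g (\<kappa> m)"
          if "m \<in> nonneg_orthant" "m' \<in> nonneg_orthant" for m m'
        proof -
          have "0 \<le> r * (norm (\<kappa> m - \<kappa> m'))\<^sup>2"
            using \<open>0 < r\<close> by simp
          then show ?thesis
            using growth[OF that(2) S[OF that(1)]] by linarith
        qed
        \<comment> \<open>The linearization error is squeezed between
          \<open>(l' - l) \<bullet> (g (\<kappa> l') - g (\<kappa> l))\<close> and 0, hence is
          quadratic in \<open>l' - l\<close>.\<close>
        have "D l' - D l - g (\<kappa> l) \<bullet> (l' - l) \<le> 0"
          using upper[OF l l'] D[OF l] by (simp add: inner_diff_left inner_commute[of "g (\<kappa> l)"])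
        moreover have "(l' - l) \<bullet> (g (\<kappa> l') - g (\<kappa> l)) \<le> D l' - D l - g (\<kappa> l) \<bullet> (l' - l)"
          using upper[OF l' l] D[OF l']
          by (simp add: inner_diff_right inner_diff_left inner_commute[of "g (\<kappa> l)"])
        ultimately have "norm (D l' - D l - g (\<kappa> l) \<bullet> (l' - l)) \<le> \<bar>(l' - l) \<bullet> (g (\<kappa> l') - g (\<kappa> l))\<bar>"
          by simp
        also have "\<dots> \<le> norm (l' - l) * (\<mu> * norm (l' - l))"
          by (rule order_trans[OF Cauchy_Schwarz_ineq2 mult_left_mono[OF \<mu>']]) simp
        also have "\<dots> \<le> norm (l' - l) * e"
          by (intro mult_left_mono near) simp
        finally show "norm (D l' - D l - g (\<kappa> l) \<bullet> (l' - l)) \<le> e * norm (l' - l)"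
          by (simp add: mult.commute)
      qed
    qed
  qed
  show ?thesis
    using lip[of \<rho>] that by (auto simp: gradient)
qed

section \<open>Applying the abstract bound to the Lagrangian\<close>

lemma pos_def_lower_bound:
  fixes P :: "real ^ 'n ^ 'n"
  assumes "pos_def P"
  obtains q where "0 < q" "\<And>x. q * (norm x)\<^sup>2 \<le> x \<bullet> (P *v x)"
proof -
  \<comment> \<open>The constant is the minimum of the form over the compact unit sphere;
    homogeneity extends the bound to all vectors.\<close>
  have "continuous_on (sphere 0 1) (\<lambda>x. x \<bullet> (P *v x))"
    by (intro continuous_intros matrix_vector_mult_linear_continuous_on)
  moreover have "(sphere 0 1 :: (real ^ 'n) set) \<noteq> {}"
    by simp
  ultimately have "\<exists>u\<in>sphere 0 1. \<forall>y\<in>sphere 0 1. u \<bullet> (P *v u) \<le> y \<bullet> (P *v y)"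
    by (intro continuous_attains_inf compact_sphere)
  then obtain u where u: "u \<in> sphere 0 1" "\<And>y. y \<in> sphere 0 1 \<Longrightarrow> u \<bullet> (P *v u) \<le> y \<bullet> (P *v y)"
    by blast
  have "(u \<bullet> (P *v u)) * (norm x)\<^sup>2 \<le> x \<bullet> (P *v x)" for x
  proof (cases "x = 0")
    case False
    define y where "y = inverse (norm x) *\<^sub>R x"
    have "u \<bullet> (P *v u) \<le> y \<bullet> (P *v y)"
      using False by (intro u) (simp add: y_def)
    also have "y \<bullet> (P *v y) = (x \<bullet> (P *v x)) / (norm x)\<^sup>2"
      by (simp add: y_def matrix_vector_mult_scaleR power2_eq_square field_simps)
    finally show ?thesis
      using False by (simp add: field_simps)
  qed simp
  moreover have "0 < u \<bullet> (P *v u)"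
  proof -
    have "u \<noteq> 0" using u(1) by auto
    then show ?thesis using assms by (simp add: pos_def_def)
  qed
  ultimately show ?thesis
    using that by blast
qed

text \<open>Nonnegative multipliers only add positive semidefinite weights, so the lower bounds
  \<open>q\<close> and \<open>r\<close> of \<open>Q0\<close> and \<open>R0\<close> survive. The
  growth constant \<open>r\<close> is therefore the same for all multipliers.\<close>

lemma optimal_lagrangian_gain_exists:
  fixes l :: "real ^ 'k"
  assumes Q0: "transpose Q0 = Q0" "\<And>x. q * (norm x)\<^sup>2 \<le> x \<bullet> (Q0 *v x)" "0 < q"
    and R0: "transpose R0 = R0" "\<And>x. r * (norm x)\<^sup>2 \<le> x \<bullet> (R0 *v x)" "0 < r"
    and Q: "\<And>i. pos_semidef (Q i)" and R: "\<And>i. pos_semidef (R i)"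
    and l: "l \<in> nonneg_orthant" and K0: "square_summable_powers (A - B ** K0)"
  obtains K where "square_summable_powers (A - B ** K)"
    "\<And>K'. square_summable_powers (A - B ** K') \<Longrightarrow>
      gain_cost A B Q0 R0 K + (\<Sum>i\<in>UNIV. l $ i * gain_cost A B (Q i) (R i) K) + r * (norm (K' - K))\<^sup>2
      \<le> gain_cost A B Q0 R0 K' + (\<Sum>i\<in>UNIV. l $ i * gain_cost A B (Q i) (R i) K')"
proof -
  have sym: "transpose (W + (\<Sum>i\<in>UNIV. l $ i *\<^sub>R V i)) = W + (\<Sum>i\<in>UNIV. l $ i *\<^sub>R V i)"
    if "transpose W = W" "\<And>i. pos_semidef (V i)" for W :: "real ^ 'p ^ 'p" and V
    using that by (simp add: vec_eq_iff transpose_def pos_semidef_def)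
  have low: "w * (norm x)\<^sup>2 \<le> x \<bullet> ((W + (\<Sum>i\<in>UNIV. l $ i *\<^sub>R V i)) *v x)"
    if "w * (norm x)\<^sup>2 \<le> x \<bullet> (W *v x)" "\<And>i. pos_semidef (V i)"
    for W :: "real ^ 'p ^ 'p" and V and w x
  proof -
    have "x \<bullet> ((\<Sum>i\<in>UNIV. l $ i *\<^sub>R V i) *v x) = (\<Sum>i\<in>UNIV. l $ i * (x \<bullet> (V i *v x)))"
      by (simp add: quadratic_form_eq_inner inner_sum_left)
    also have "\<dots> \<ge> 0"
      using that(2) l by (intro sum_nonneg mult_nonneg_nonneg) (auto simp: nonneg_orthant_def pos_semidef_def)
    finally show ?thesis
      using that(1) by (simp add: matrix_vector_mult_add_rdistrib inner_add_right)
  qed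
  have eq: "gain_cost A B (Q0 + (\<Sum>i\<in>UNIV. l $ i *\<^sub>R Q i)) (R0 + (\<Sum>i\<in>UNIV. l $ i *\<^sub>R R i)) K
      = gain_cost A B Q0 R0 K + (\<Sum>i\<in>UNIV. l $ i * gain_cost A B (Q i) (R i) K)" for K
    by (simp add: gain_cost_add gain_cost_sum gain_cost_scaleR)
  let ?Q = "Q0 + (\<Sum>i\<in>UNIV. l $ i *\<^sub>R Q i)" and ?R = "R0 + (\<Sum>i\<in>UNIV. l $ i *\<^sub>R R i)"
  have "transpose ?Q = ?Q" "\<And>x. q * (norm x)\<^sup>2 \<le> x \<bullet> (?Q *v x)"
    by (rule sym low; fact Q0 Q)+
  moreover have "transpose ?R = ?R" "\<And>x. r * (norm x)\<^sup>2 \<le> x \<bullet> (?R *v x)"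
    by (rule sym low; fact R0 R)+
  ultimately obtain K where "square_summable_powers (A - B ** K)"
    "\<And>K'. square_summable_powers (A - B ** K')
      \<Longrightarrow> gain_cost A B ?Q ?R K + r * (norm (K' - K))\<^sup>2 \<le> gain_cost A B ?Q ?R K'"
    using optimal_gain_exists[of ?Q q ?R r A B K0] Q0(3) R0(3) K0 by blast
  then show ?thesis
    by (intro that[of K]) (simp_all only: eq)
qed

theorem lemma4:
  fixes M :: "'a measure" and x0 :: "'a \<Rightarrow> real ^ 'n"
    and A :: "real ^ 'n ^ 'n" and B :: "real ^ 'm ^ 'n"
    and Q0 :: "real ^ 'n ^ 'n" and R0 :: "real ^ 'm ^ 'm"
    and Q :: "'k::finite \<Rightarrow> real ^ 'n ^ 'n" and R :: "'k \<Rightarrow> real ^ 'm ^ 'm"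
    and c :: "'k \<Rightarrow> real"
    and \<Omega> :: "(real ^ 'k) set" and lstar :: "real ^ 'k"
  assumes "prob_space M"
    and "x0 \<in> borel_measurable M"
    and "(\<integral>\<omega>. x0 \<omega> \<partial>M) = 0"
    and "(\<integral>\<omega>. (\<chi> i j. x0 \<omega> $ i * x0 \<omega> $ j) \<partial>M) = (mat 1 :: real ^ 'n ^ 'n)"
    and "controllable A B"
    and "pos_def Q0" and "pos_def R0"
    and "\<And>i. pos_semidef (Q i)" and "\<And>i. pos_semidef (R i)"
    and slater: "\<exists>K\<in>stabilizing A B. \<forall>i. lq_cost M x0 A B (Q i) (R i) K < c i"
    and "is_arg_max (dual_fun M x0 A B Q0 R0 Q R c) (\<lambda>l. l \<in> nonneg_orthant) lstar"
    and "compact \<Omega>" and "\<Omega> \<subseteq> nonneg_orthant" and "lstar \<in> \<Omega>"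
  shows "\<exists>\<gamma>1 > 0. \<exists>\<mu> > 0. \<forall>l\<in>\<Omega>. \<forall>l'\<in>\<Omega>. norm (l' - l) \<le> \<gamma>1 \<longrightarrow>
           norm (orthant_gradient (dual_fun M x0 A B Q0 R0 Q R c) l'
               - orthant_gradient (dual_fun M x0 A B Q0 R0 Q R c) l) \<le> \<mu> * norm (l' - l)"
proof -
  note psd = assms(8,9)
  have sym0: "transpose Q0 = Q0" "transpose R0 = R0"
    using assms(6,7) by (auto simp: pos_def_def)
  obtain q where q: "0 < q" "\<And>x. q * (norm x)\<^sup>2 \<le> x \<bullet> (Q0 *v x)"
    using pos_def_lower_bound[OF assms(6)] by blast
  obtain r where r: "0 < r" "\<And>x. r * (norm x)\<^sup>2 \<le> x \<bullet> (R0 *v x)"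
    using pos_def_lower_bound[OF assms(7)] by blast
  have Q0: "0 \<le> x \<bullet> (Q0 *v x)" for x
    using q(2)[of x] q(1) by (meson order_trans mult_nonneg_nonneg zero_le_power2 less_imp_le)
  have R0: "0 \<le> x \<bullet> (R0 *v x)" for x
    using r(2)[of x] r(1) by (meson order_trans mult_nonneg_nonneg zero_le_power2 less_imp_le)
  obtain Kt where Kt: "Kt \<in> stabilizing A B"
    using slater by blast
  define D where "D = dual_fun M x0 A B Q0 R0 Q R c"
  define f where "f = gain_cost A B Q0 R0"
  define g where "g K = (\<chi> i. gain_cost A B (Q i) (R i) K - c i)" for K
  have lagr: "lagrangian M x0 A B Q0 R0 Q R c K l = f K + l \<bullet> g K" if "K \<in> stabilizing A B" for K l
    by (simp add: lagrangian_def f_def g_def inner_vec_def lq_cost_eq_gain_cost[OF assms(4) that])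
  have "\<exists>K. K \<in> stabilizing A B \<and> (\<forall>K'\<in>stabilizing A B.
      f K + l \<bullet> g K + r * (norm (K' - K))\<^sup>2 \<le> f K' + l \<bullet> g K')" if l: "l \<in> nonneg_orthant" for l
  proof -
    \<comment> \<open>The thresholds \<open>c\<close> contribute a term free of the gain, which
      cancels on both sides of the growth inequality.\<close>
    have lg: "l \<bullet> g K = (\<Sum>i\<in>UNIV. l $ i * gain_cost A B (Q i) (R i) K) - (\<Sum>i\<in>UNIV. l $ i * c i)" for K
      by (simp add: inner_vec_def g_def right_diff_distrib sum_subtractf)
    obtain K where "square_summable_powers (A - B ** K)"
      and "\<And>K'. square_summable_powers (A - B ** K') \<Longrightarrow>
        gain_cost A B Q0 R0 K + (\<Sum>i\<in>UNIV. l $ i * gain_cost A B (Q i) (R i) K) + r * (norm (K' - K))\<^sup>2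
        \<le> gain_cost A B Q0 R0 K' + (\<Sum>i\<in>UNIV. l $ i * gain_cost A B (Q i) (R i) K')"
      by (rule optimal_lagrangian_gain_exists[where Q = Q and R = R,
            OF sym0(1) q(2,1) sym0(2) r(2,1) psd l Kt[unfolded stabilizing_iff]])
        (rule that)
    then show ?thesis
      unfolding lg f_def by (intro exI[of _ K]) (auto simp: stabilizing_iff algebra_simps)
  qed
  then obtain \<kappa> where \<kappa>: "\<And>l. l \<in> nonneg_orthant \<Longrightarrow> \<kappa> l \<in> stabilizing A B"
    and growth: "\<And>l K. l \<in> nonneg_orthant \<Longrightarrow> K \<in> stabilizing A B
      \<Longrightarrow> f (\<kappa> l) + l \<bullet> g (\<kappa> l) + r * (norm (K - \<kappa> l))\<^sup>2 \<le> f K + l \<bullet> g K"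
    by metis
  have min: "f (\<kappa> l) + l \<bullet> g (\<kappa> l) \<le> f K + l \<bullet> g K" if "l \<in> nonneg_orthant" "K \<in> stabilizing A B" for l K
    using growth[OF that] mult_nonneg_nonneg[OF less_imp_le[OF r(1)] zero_le_power2[of "norm (K - \<kappa> l)"]]
    by linarith
  have D: "D l = f (\<kappa> l) + l \<bullet> g (\<kappa> l)" if l: "l \<in> nonneg_orthant" for l
    unfolding D_def dual_fun_def
    by (rule Least_equality) (use \<kappa>[OF l] min[OF l] lagr in auto)
  have growth_D: "D l + r * (norm (K - \<kappa> l))\<^sup>2 \<le> f K + l \<bullet> g K"
    if "l \<in> nonneg_orthant" "K \<in> stabilizing A B" for l K
    using growth[OF that] D[OF that(1)] by simp
  have lipschitz: "\<exists>G\<ge>0. \<forall>l\<in>nonneg_orthant. \<forall>l'\<in>nonneg_orthant. norm l \<le> \<rho> \<longrightarrow> norm l' \<le> \<rho>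
      \<longrightarrow> norm (g (\<kappa> l') - g (\<kappa> l)) \<le> G * norm (\<kappa> l' - \<kappa> l)" for \<rho>
  proof -
    \<comment> \<open>Comparing \<open>\<kappa> l\<close> with the fixed stabilizing gain
      \<open>Kt\<close>, and dropping the nonnegative constraint costs at \<open>\<kappa> l\<close>,
      bounds \<open>f (\<kappa> l)\<close> for \<open>norm l \<le> \<rho>\<close>. The absolute
      value gives \<open>0 \<le> m\<close> for every \<open>\<rho>\<close>.\<close>
    define m where "m = \<bar>f Kt + \<rho> * norm (g Kt) + \<rho> * norm (\<chi> i. c i)\<bar>"
    have f_le: "f (\<kappa> l) \<le> m" if l: "l \<in> nonneg_orthant" "norm l \<le> \<rho>" for l
    proof -
      have "0 \<le> l \<bullet> (\<chi> i. gain_cost A B (Q i) (R i) (\<kappa> l))"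
        unfolding inner_vec_def using l(1) \<kappa>[OF l(1)] psd
        by (intro sum_nonneg) (auto intro!: mult_nonneg_nonneg gain_cost_nonneg
            simp: nonneg_orthant_def stabilizing_iff pos_semidef_def)
      moreover have "l \<bullet> g (\<kappa> l) = l \<bullet> (\<chi> i. gain_cost A B (Q i) (R i) (\<kappa> l)) - l \<bullet> (\<chi> i. c i)"
        by (simp add: inner_vec_def g_def right_diff_distrib sum_subtractf)
      moreover have cs: "l \<bullet> v \<le> \<rho> * norm v" for v
        using norm_cauchy_schwarz[of l v] mult_right_mono[OF l(2) norm_ge_zero[of v]] by linarith
      ultimately show ?thesis
        using min[OF l(1) Kt] cs[of "g Kt"] cs[of "\<chi> i. c i"]
          abs_ge_self[of "f Kt + \<rho> * norm (g Kt) + \<rho> * norm (\<chi> i. c i)"]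
        unfolding m_def by linarith
    qed
    have "\<exists>G\<ge>0. \<forall>K K'. K \<in> stabilizing A B \<longrightarrow> K' \<in> stabilizing A B \<longrightarrow> f K \<le> m \<longrightarrow> f K' \<le> m \<longrightarrow>
        \<bar>gain_cost A B (Q i) (R i) K' - gain_cost A B (Q i) (R i) K\<bar> \<le> G * norm (K' - K)" for i
    proof -
      have "0 \<le> m" by (simp add: m_def)
      obtain G where "0 \<le> G" and G: "\<And>K K'. \<lbrakk>square_summable_powers (A - B ** K); square_summable_powers (A - B ** K');
        norm K \<le> sqrt (m / r); norm K' \<le> sqrt (m / r); (\<Sum>t. (norm (mpow (A - B ** K) t))\<^sup>2) \<le> m / q;
        (\<Sum>t. (norm (mpow (A - B ** K') t))\<^sup>2) \<le> m / q\<rbrakk>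
        \<Longrightarrow> \<bar>gain_cost A B (Q i) (R i) K' - gain_cost A B (Q i) (R i) K\<bar> \<le> G * norm (K' - K)"
        using gain_cost_lipschitz[of "Q i" "R i" "sqrt (m / r)" "m / q" A B] psd \<open>0 \<le> m\<close> q(1) r(1)
        by (auto simp: pos_semidef_def)
      \<comment> \<open>On a sublevel set of \<open>f\<close>, positive definiteness of
        \<open>R0\<close> bounds the gain and that of \<open>Q0\<close> bounds the closed-loop
        powers.\<close>
      have "norm K \<le> sqrt (m / r) \<and> (\<Sum>t. (norm (mpow (A - B ** K) t))\<^sup>2) \<le> m / q"
        if "square_summable_powers (A - B ** K)" "f K \<le> m" for K
      proof
        have "r * (norm K)\<^sup>2 \<le> m"
          using gain_cost_ge_norm_gain[OF that(1) Q0 r(2)] r(1) that(2) by (simp add: f_def)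
        then show "norm K \<le> sqrt (m / r)"
          using r(1) by (intro real_le_rsqrt) (simp add: field_simps)
        have "gain_cost A B Q0 R0 K / q \<le> m / q"
          using that(2) q(1) by (simp add: f_def divide_right_mono)
        then show "(\<Sum>t. (norm (mpow (A - B ** K) t))\<^sup>2) \<le> m / q"
          using suminf_norm_mpow_le[OF that(1) q(2,1) R0] by linarith
      qed
      then show ?thesis
        using \<open>0 \<le> G\<close> by (intro exI[of _ G]) (simp add: stabilizing_iff G)
    qed
    then obtain G where G: "\<And>i. 0 \<le> G i" "\<And>i K K'. \<lbrakk>K \<in> stabilizing A B; K' \<in> stabilizing A B; f K \<le> m; f K' \<le> m\<rbrakk>
        \<Longrightarrow> \<bar>gain_cost A B (Q i) (R i) K' - gain_cost A B (Q i) (R i) K\<bar> \<le> G i * norm (K' - K)"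
      by metis
    show ?thesis
    proof (intro exI[of _ "\<Sum>i\<in>UNIV. G i"] conjI ballI impI sum_nonneg G(1))
      fix l l' :: "real ^ 'k"
      assume l: "l \<in> nonneg_orthant" "l' \<in> nonneg_orthant" "norm l \<le> \<rho>" "norm l' \<le> \<rho>"
      have "norm (g (\<kappa> l') - g (\<kappa> l)) \<le> (\<Sum>i\<in>UNIV. \<bar>(g (\<kappa> l') - g (\<kappa> l)) $ i\<bar>)"
        by (rule norm_le_l1_cart)
      also have "\<dots> \<le> (\<Sum>i\<in>UNIV. G i * norm (\<kappa> l' - \<kappa> l))"
        using G(2)[OF \<kappa>[OF l(1)] \<kappa>[OF l(2)] f_le[OF l(1,3)] f_le[OF l(2,4)]]
        by (intro sum_mono) (simp add: g_def)
      finally show "norm (g (\<kappa> l') - g (\<kappa> l)) \<le> (\<Sum>i\<in>UNIV. G i) * norm (\<kappa> l' - \<kappa> l)"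
        by (simp add: sum_distrib_right)
    qed
  qed
  obtain \<rho> where \<rho>: "\<And>l. l \<in> \<Omega> \<Longrightarrow> norm l \<le> \<rho>"
    using compact_imp_bounded[OF assms(12)] by (auto simp: bounded_iff)
  obtain \<mu> where "0 < \<mu>" and \<mu>: "\<And>l l'. \<lbrakk>l \<in> nonneg_orthant; l' \<in> nonneg_orthant; norm l \<le> \<rho>; norm l' \<le> \<rho>\<rbrakk>
      \<Longrightarrow> norm (orthant_gradient D l' - orthant_gradient D l) \<le> \<mu> * norm (l' - l)"
    by (rule orthant_gradient_lipschitz_on_bounded[of \<kappa> "stabilizing A B" D f g r \<rho>,
          OF \<kappa> D growth_D r(1) lipschitz])
        (assumption | rule that)+
  \<comment> \<open>The estimate holds for all pairs in the bounded set \<open>\<Omega>\<close>, so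
    the radius can be taken as 1.\<close>
  show ?thesis
    unfolding D_def[symmetric]
    using \<open>0 < \<mu>\<close> \<mu> \<rho> assms(13)
    by (intro exI[of _ 1] exI[of _ \<mu>] conjI ballI impI) auto
qed

end
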